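(* As $N\to\infty$, $$\frac1N\sum_{n=2}^{N}\log\frac{s(n)}{n}=-e^{-\gamma}\log\log N+O(\log\log\log N),$$ where $\gamma$ is Euler's constant.
   Context: For an integer $n>1$, $s(n)=\sum_{d\mid n,\ d<n}d=\sigma(n)-n$, where $\sigma(n)=\sum_{d\mid n}d$. *)

theory Defs
  imports "HOL-Analysis.Analysis" "HOL-Library.Landau_Symbols"
begin

definition aliquot_sum :: "nat \<Rightarrow> nat" where
  "aliquot_sum n = (\<Sum>d \<in> {d. d dvd n \<and> d < n}. d)"

end

theory Submission
  imports Defs "HOL-Number_Theory.Prime_Powers" "HOL-Real_Asymp.Real_Asymp"
begin

text \<open>
  Let \<open>p(n)\<close> be the least prime factor of \<open>n\<close>. Since \<open>s(n) / n\<close> is the sum of \<open>1 / d\<close> over the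
  divisors \<open>d > 1\<close> of \<open>n\<close>, the product \<open>p(n) s(n) / n\<close> is at least \<open>1\<close>, and a sieve bound shows that
  its mean is bounded. Hence \<open>ln (s(n) / n)\<close> may be replaced by \<open>- ln p(n)\<close>, with a bounded error in
  the mean. Writing \<open>ln p\<close> as a harmonic sum, the sum of \<open>ln p(n)\<close> over \<open>n \<le> N\<close> becomes the sum of
  \<open>\<Phi>(N, j) / j\<close> over \<open>j \<le> N\<close>, where \<open>\<Phi>(N, j)\<close> counts the \<open>n \<le> N\<close> without prime factors below \<open>j\<close>.
  For \<open>ln j \<le> ln N / (5 ln ln N)\<close>, Legendre's sieve with Rankin's trick and Mertens' third theorem
  give \<open>\<Phi>(N, j) \<approx> N exp (- \<gamma>) / ln j\<close>; for the remaining \<open>j\<close> the bound \<open>\<Phi>(N, j) = O(N / ln j)\<close>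
  costs only \<open>O(ln ln ln N)\<close>.
\<close>

subsection \<open>Chebyshev's bound and Mertens' first theorem\<close>

text \<open>The quantity ln (s(n) / n) is unbounded below, since a prime n gives - ln n, so a bound
  for the mean of s(n) / n alone cannot control it. Multiplying by p(n) cures this: the logarithm of
  the product is nonnegative, and ln t \<le> t turns a bounded mean of the product into a bounded
  mean of its logarithm. Mertens' third theorem is needed with an error term: a relative error O(1 /
  ln j) in the sieve density becomes 1 / (j (ln j)^2) after division by j, which is summable. The 5
  balances the sieve. Rankin's trick loses a factor (ln j)^3, while exp (- ln N / ln j) \<le> (ln
  N)^(-5) in the stated range, so that (ln N)^(-2) remains, and this beats the sum of 1 / j up to N.
  The remaining range, ln N / (5 ln ln N) < ln j \<le> ln N, has length ln (5 ln ln N) on the scale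
  of ln ln j; it is the only source of an unbounded error.\<close>

definition cheb_psi :: "nat \<Rightarrow> real" where
  "cheb_psi n = (\<Sum>d=1..n. mangoldt d)"

text \<open>From n to n + 1 the quotient \<open>n div d\<close> grows by one exactly when d divides
  n + 1, and the von Mangoldt function sums to ln (n + 1) over these d.\<close>

lemma sum_mangoldt_div: "(\<Sum>d=1..n. mangoldt d * real (n div d)) = ln (fact n)"
proof (induction n)
  case (Suc n)
  have "(\<Sum>d=1..Suc n. mangoldt d * real (Suc n div d)) =
        (\<Sum>d=1..Suc n. mangoldt d * real (n div d) + (if d dvd Suc n then mangoldt d else 0))"
    by (intro sum.cong refl) (auto simp: div_Suc dvd_eq_mod_eq_0 algebra_simps)
  also have "\<dots> = (\<Sum>d=1..n. mangoldt d * real (n div d)) +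
      (\<Sum>d\<in>{1..Suc n}. if d dvd Suc n then mangoldt d else 0)"
    by (simp add: sum.distrib)
  also have "(\<Sum>d\<in>{1..Suc n}. if d dvd Suc n then mangoldt d else 0) =
               (\<Sum>d\<in>{d\<in>{1..Suc n}. d dvd Suc n}. mangoldt d :: real)"
    by (rule sum.inter_filter[symmetric]) simp
  also have "{d\<in>{1..Suc n}. d dvd Suc n} = {d. d dvd Suc n}"
    using dvd_imp_le[of _ "Suc n"] by (auto simp: Suc_le_eq intro!: Nat.gr0I)
  also have "(\<Sum>d | d dvd Suc n. mangoldt d) = ln (real (Suc n))"
    using mangoldt_sum[of "Suc n", where 'a = real] by simp
  finally show ?case
    unfolding Suc.IH by (simp add: ln_mult fact_Suc add.commute del: of_nat_Suc sum.cl_ivl_Suc)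
qed simp

lemma cheb_psi_mono: "m \<le> n \<Longrightarrow> cheb_psi m \<le> cheb_psi n"
  unfolding cheb_psi_def by (intro sum_mono2) (auto simp: mangoldt_nonneg)

text \<open>Chebyshev's argument: \<open>2*m div d - 2 * (m div d)\<close> is never negative and is
  at least 1 for m < d \<le> 2m, and its sum against \<open>mangoldt\<close> is the logarithm of the
  central binomial coefficient.\<close>

lemma cheb_psi_double: "cheb_psi (2 * m) \<le> cheb_psi m + 2 * real m * ln 2"
proof -
  have "cheb_psi (2 * m) - cheb_psi m = (\<Sum>d=1..2*m. if d \<le> m then 0 else mangoldt d)"
  proof -
    have "cheb_psi (2 * m) = cheb_psi m + (\<Sum>d=m+1..2*m. mangoldt d)"
      unfolding cheb_psi_def using sum.ub_add_nat[of 1 m mangoldt m] by (simp add: mult_2)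
    also have "(\<Sum>d=m+1..2*m. mangoldt d) = (\<Sum>d=1..2*m. if d \<le> m then 0 else mangoldt d :: real)"
      by (intro sum.mono_neutral_cong_left) auto
    finally show ?thesis by simp
  qed
  also have "\<dots> \<le> (\<Sum>d=1..2*m. mangoldt d * real (2*m div d) - 2 * (mangoldt d * real (m div d)))"
  proof (intro sum_mono)
    fix d assume d: "d \<in> {1..2*m}"
    have "2 * (m div d) \<le> 2 * m div d"
      using d by (simp add: less_eq_div_iff_mult_less_eq)
    hence le: "2 * real (m div d) \<le> real (2 * m div d)"
      by (metis of_nat_le_iff of_nat_mult of_nat_numeral)
    show "(if d \<le> m then 0 else mangoldt d) \<le>
            mangoldt d * real (2*m div d) - 2 * (mangoldt d * real (m div d))"
    proof (cases "d \<le> m")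
      case True
      show ?thesis using mult_left_mono[OF le mangoldt_nonneg[of d]] True by simp
    next
      case False
      hence "m div d = 0" by simp
      moreover have "2 * m div d \<ge> 1" using d by (simp add: div_greater_zero_iff Suc_le_eq)
      ultimately show ?thesis using False mangoldt_nonneg[of d]
        by (simp add: mult_le_cancel_left1)
    qed
  qed
  also have "\<dots> = ln (fact (2*m)) - 2 * (\<Sum>d=1..2*m. mangoldt d * real (m div d))"
    unfolding sum_subtractf sum_mangoldt_div sum_distrib_left[symmetric] ..
  also have "(\<Sum>d=1..2*m. mangoldt d * real (m div d)) = (\<Sum>d=1..m. mangoldt d * real (m div d))"
    by (intro sum.mono_neutral_right) auto
  also have "\<dots> = ln (fact m)" by (rule sum_mangoldt_div)
  also have "ln (fact (2*m)) - 2 * ln (fact m) = ln (real ((2*m) choose m))"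
  proof -
    have "2 * m - m = m" by simp
    hence "real ((2*m) choose m) = fact (2*m) / (fact m * fact m)"
      using binomial_fact[of m "2*m", where 'a = real] by simp
    thus ?thesis by (simp add: ln_div ln_mult)
  qed
  also have "\<dots> \<le> ln (2 ^ (2*m))"
  proof (subst ln_le_cancel_iff)
    have "(2*m choose m) \<le> 2 ^ (2*m)" by (rule binomial_le_pow2)
    thus "real (2*m choose m) \<le> 2 ^ (2*m)" by (metis of_nat_le_iff of_nat_numeral of_nat_power)
  qed auto
  also have "\<dots> = 2 * real m * ln 2" by (simp add: ln_realpow)
  finally show ?thesis by simp
qed

text \<open>Halving, with room for odd arguments: for n = 2m - 1 the doubling bound with ln 2 \<le>
  3/4 gives 9m/2, which is at most 3 (2m - 1) once m \<ge> 2.\<close>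

lemma cheb_psi_le: "cheb_psi n \<le> 3 * real n"
proof (induction n rule: less_induct)
  case (less n)
  have ln2: "ln 2 \<le> (3/4 :: real)" using ln2_le_25_over_36 by simp
  consider "n = 0" | "n = 1" | m where "n = 2 * m" "m \<ge> 1" | m where "n = 2 * m - 1" "m \<ge> 2"
  proof -
    have "n = 0 \<or> n = 1 \<or> (\<exists>m\<ge>1. n = 2 * m) \<or> (\<exists>m\<ge>2. n = 2*m - 1)"
    proof (cases "even n")
      case True then show ?thesis by (auto elim!: evenE)
    next
      case False
      then obtain k where "n = 2 * k + 1" by (auto elim: oddE)
      thus ?thesis by (cases "k = 0") (auto intro!: exI[of _ "k+1"])
    qed
    thus ?thesis using that by blast
  qed
  thus ?case
  proof cases
    case 3
    have "cheb_psi n \<le> cheb_psi m + 2 * real m * ln 2" using cheb_psi_double 3 by simp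
    also have "cheb_psi m \<le> 3 * real m" using 3 less.IH[of m] by simp
    also have "2 * real m * ln 2 \<le> 2 * real m * (3/4)" by (intro mult_left_mono ln2) auto
    finally show ?thesis using 3 by simp
  next
    case 4
    have "cheb_psi n \<le> cheb_psi (2*m)" using 4 by (intro cheb_psi_mono) auto
    also have "\<dots> \<le> cheb_psi m + 2 * real m * ln 2" by (rule cheb_psi_double)
    also have "cheb_psi m \<le> 3 * real m" using 4 less.IH[of m] by simp
    also have "2 * real m * ln 2 \<le> 2 * real m * (3/4)" by (intro mult_left_mono ln2) auto
    finally show ?thesis using 4 by (simp add: of_nat_diff)
  qed (auto simp: cheb_psi_def)
qed

text \<open>The single term n^n / n! of the exponential series is at most exp n, which gives the
  lower bound; the upper one is n! \<le> n^n.\<close>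

lemma ln_fact_bounds:
  assumes "n \<ge> 1"
  shows "ln (fact n) \<ge> real n * ln (real n) - real n" "ln (fact n) \<le> real n * ln (real n)"
proof -
  have "real n ^ n / fact n \<le> exp (real n)"
  proof -
    have s: "(\<lambda>k. real n ^ k / fact k) sums exp (real n)"
      using exp_converges[of "real n"] by (simp add: field_simps scaleR_conv_of_real)
    have "(\<Sum>k\<in>{n}. real n ^ k / fact k) \<le> exp (real n)"
      by (intro sum_le_suminf[OF sums_summable[OF s], unfolded sums_unique[OF s, symmetric]]) auto
    thus ?thesis by simp
  qed
  hence "ln (real n ^ n / fact n) \<le> ln (exp (real n))"
    using assms by (subst ln_le_cancel_iff) auto
  thus "ln (fact n) \<ge> real n * ln (real n) - real n"
    using assms by (simp add: ln_div ln_realpow)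
  have "fact n \<le> real n ^ n"
    using fact_le_power[of n] by simp
  hence "ln (fact n) \<le> ln (real n ^ n)" using assms by (subst ln_le_cancel_iff) auto
  thus "ln (fact n) \<le> real n * ln (real n)" using assms by (simp add: ln_realpow)
qed

text \<open>Replacing \<open>n div d\<close> by n / d in the formula for ln n! changes the sum by at
  most \<open>cheb_psi n\<close>. Chebyshev's bound for it is the source of the 3.\<close>

lemma sum_mangoldt_over_id_bounds:
  assumes "n \<ge> 1"
  shows "(\<Sum>d=1..n. mangoldt d / real d) \<ge> ln (real n) - 1"
        "(\<Sum>d=1..n. mangoldt d / real d) \<le> ln (real n) + 3"
proof -
  have "ln (fact n) \<le> (\<Sum>d=1..n. real n * (mangoldt d / real d))"
    unfolding sum_mangoldt_div[symmetric]
  proof (rule sum_mono)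
    fix d assume "d \<in> {1..n}"
    have "real (n div d) \<le> real n / real d" by (rule of_nat_div_le_of_nat)
    from mult_left_mono[OF this mangoldt_nonneg[of d]]
    show "mangoldt d * real (n div d) \<le> real n * (mangoldt d / real d)" by (simp add: mult_ac)
  qed
  also have "\<dots> = real n * (\<Sum>d=1..n. mangoldt d / real d)" by (simp add: sum_distrib_left)
  finally have "real n * (ln (real n) - 1) \<le> real n * (\<Sum>d=1..n. mangoldt d / real d)"
    using ln_fact_bounds(1)[OF assms] by (simp add: algebra_simps)
  thus "(\<Sum>d=1..n. mangoldt d / real d) \<ge> ln (real n) - 1" using assms by simp
  have "real n * (\<Sum>d=1..n. mangoldt d / real d) = (\<Sum>d=1..n. real n * (mangoldt d / real d))"
    by (simp add: sum_distrib_left)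
  also have "\<dots> \<le> (\<Sum>d=1..n. mangoldt d * real (n div d) + mangoldt d)"
  proof (rule sum_mono)
    fix d assume d: "d \<in> {1..n}"
    have "real n / real d \<le> real (n div d) + 1"
      using floor_divide_of_nat_eq[of n d, where 'a = real] by linarith
    from mult_left_mono[OF this mangoldt_nonneg[of d]]
    show "real n * (mangoldt d / real d) \<le> mangoldt d * real (n div d) + mangoldt d"
      by (simp add: algebra_simps)
  qed
  also have "\<dots> = ln (fact n) + cheb_psi n"
    unfolding sum.distrib sum_mangoldt_div cheb_psi_def ..
  also have "\<dots> \<le> real n * ln (real n) + 3 * real n"
    by (intro add_mono ln_fact_bounds assms cheb_psi_le)
  also have "\<dots> = real n * (ln (real n) + 3)" by (simp add: algebra_simps)
  finally show "(\<Sum>d=1..n. mangoldt d / real d) \<le> ln (real n) + 3" using assms by simp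
qed

text \<open>The weight - ln (1 - 1/p) is preferred to 1/p because the exponential of its negated sum
  is the product of the factors 1 - 1/p itself, so no correction constant separates Mertens'
  theorems from the sieve.\<close>

definition prime_log :: "nat \<Rightarrow> real" where
  "prime_log n = (if prime n then - ln (1 - 1 / real n) else 0)"

lemma neg_ln_one_minus_bounds:
  assumes "0 \<le> u" "u \<le> (1/2::real)"
  shows "u \<le> - ln (1 - u)" "- ln (1 - u) \<le> u + 2 * u\<^sup>2"
proof -
  show "u \<le> - ln (1 - u)" using ln_le_minus_one[of "1 - u"] assms by simp
  show "- ln (1 - u) \<le> u + 2 * u\<^sup>2" using ln_one_minus_pos_lower_bound[of u] assms by simp
qed

lemma prime_log_bounds:
  assumes "prime n"
  shows "1 / real n \<le> prime_log n" "prime_log n \<le> 1 / real n + 2 / (real n)\<^sup>2"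
        "prime_log n \<le> 2 / real n"
proof -
  have n: "real n \<ge> 2" using prime_ge_2_nat[OF assms] by simp
  have u: "0 \<le> 1 / real n" "1 / real n \<le> 1 / 2" using n by (auto simp: field_simps)
  show "1 / real n \<le> prime_log n" and *: "prime_log n \<le> 1 / real n + 2 / (real n)\<^sup>2"
    using neg_ln_one_minus_bounds[OF u] assms by (auto simp: prime_log_def power_divide)
  have "2 / (real n)\<^sup>2 \<le> 1 / real n" using n by (simp add: power2_eq_square field_simps)
  with * show "prime_log n \<le> 2 / real n" by simp
qed

lemma prime_log_nonneg: "prime_log n \<ge> 0"
proof (cases "prime n")
  case True
  have "0 \<le> 1 / real n" by simp
  also have "\<dots> \<le> prime_log n" by (rule prime_log_bounds(1)[OF True])
  finally show ?thesis .
qed (simp add: prime_log_def)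

lemma summable_ln_over_square: "summable (\<lambda>n. ln (real n) / (real n)\<^sup>2)"
proof (rule summable_comparison_test_bigo)
  show "summable (\<lambda>n. norm (real n powr (-3/2)))"
    by (simp add: summable_real_powr_iff)
  show "(\<lambda>n. ln (real n) / (real n)\<^sup>2) \<in> O(\<lambda>n. real n powr (-3/2))"
    by real_asymp
qed

text \<open>One constant for all contributions of order ln p / p^2: the higher prime powers, the
  difference between \<open>prime_log p\<close> and 1/p, and the error of twisting by
  \<open>p powr (-d)\<close>.\<close>

definition ln_sq_const :: real where
  "ln_sq_const = (\<Sum>n. ln (real n) / (real n)\<^sup>2)"

lemma sum_ln_over_square_le:
  "finite A \<Longrightarrow> (\<Sum>n\<in>A. ln (real n) / (real n)\<^sup>2) \<le> ln_sq_const"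
  unfolding ln_sq_const_def
proof (rule sum_le_suminf[OF summable_ln_over_square])
  show "ln (real n) / (real n)\<^sup>2 \<ge> 0" for n :: nat
    by (cases "n = 0") auto
qed auto

lemma ln_sq_const_nonneg: "ln_sq_const \<ge> 0"
  using sum_ln_over_square_le[of "{}"] by simp

lemma sum_power_from_2_le:
  fixes q :: real
  assumes "0 \<le> q" "q \<le> 1/2"
  shows "(\<Sum>k=2..n. q ^ k) \<le> 2 * q\<^sup>2"
proof -
  \<comment> \<open>The subtracted remainder carries the induction: half of it pays for the new
    term, and the other half covers the next remainder because q \<le> 1/2.\<close>
  have "(\<Sum>k=2..Suc m. q ^ k) \<le> 2 * q\<^sup>2 - 2 * q ^ (m + 2)" for m
  proof (induction m)
    case (Suc m)
    have "q ^ (m + 2) * q \<le> q ^ (m + 2) * (1/2)" using assms by (intro mult_left_mono) auto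
    moreover have "(\<Sum>k=2..Suc (Suc m). q ^ k) = (\<Sum>k=2..Suc m. q ^ k) + q ^ (m + 2)" by simp
    moreover have "q ^ (Suc m + 2) = q ^ (m + 2) * q" by simp
    ultimately show ?case using Suc.IH by linarith
  qed (simp add: power2_eq_square)
  note * = this
  show ?thesis
  proof (cases n)
    case (Suc m)
    have "q ^ (m + 2) \<ge> 0" using assms by simp
    thus ?thesis unfolding Suc using *[of m] by linarith
  qed (use assms in auto)
qed

text \<open>Only prime powers p^k with k \<ge> 2 contribute. For each p they form a geometric series
  of size at most 2 ln p / p^2.\<close>

lemma sum_mangoldt_nonprime_le:
  "(\<Sum>n\<in>{n\<in>{1..x}. \<not>prime n}. mangoldt n / real n) \<le> 2 * ln_sq_const"
proof -
  define T where "T = {p\<in>{2..x}. prime p} \<times> {2..x}"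
  define h where "h = (\<lambda>(p::nat,k::nat). p ^ k)"
  define f :: "nat \<Rightarrow> real" where "f = (\<lambda>n. mangoldt n / real n)"
  have fnn: "f n \<ge> 0" for n by (simp add: f_def mangoldt_nonneg)
  have "(\<Sum>n\<in>{n\<in>{1..x}. \<not>prime n}. f n) = (\<Sum>n\<in>{n\<in>{1..x}. primepow n \<and> \<not>prime n}. f n)"
    by (intro sum.mono_neutral_right) (auto simp: f_def mangoldt_def)
  also have "\<dots> \<le> sum f (h ` T)"
  proof (intro sum_mono2)
    \<comment> \<open>Both p and k are at most p^k, so the box of pairs up to x captures every
      proper prime power up to x.\<close>
    show "{n\<in>{1..x}. primepow n \<and> \<not>prime n} \<subseteq> h ` T"
    proof
      fix n assume n: "n \<in> {n\<in>{1..x}. primepow n \<and> \<not>prime n}"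
      then obtain p k where pk: "prime p" "k > 0" "n = p ^ k" by (auto simp: primepow_def)
      have "k \<noteq> 1" using n pk by auto
      with pk have k: "k \<ge> 2" by simp
      have p2: "p \<ge> 2" using pk prime_ge_2_nat by simp
      have "p ^ 1 \<le> p ^ k" using pk p2 by (intro power_increasing) auto
      moreover have "k \<le> x" using self_le_ge2_pow[OF p2, of k] n pk by simp
      ultimately show "n \<in> h ` T" using n pk k p2
        by (auto simp: T_def h_def intro!: image_eqI[of _ _ "(p,k)"])
    qed
  qed (auto simp: T_def fnn)
  also have "\<dots> \<le> sum (f \<circ> h) T"
    by (intro sum_image_le) (auto simp: T_def fnn)
  also have "\<dots> = (\<Sum>p\<in>{p\<in>{2..x}. prime p}. \<Sum>k=2..x. ln (real p) * (1 / real p) ^ k)"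
    unfolding T_def sum.cartesian_product
    by (intro sum.cong refl) (auto simp: f_def h_def power_divide)
  also have "\<dots> \<le> (\<Sum>p\<in>{p\<in>{2..x}. prime p}. 2 * (ln (real p) / (real p)\<^sup>2))"
  proof (intro sum_mono)
    fix p assume p: "p \<in> {p\<in>{2..x}. prime p}"
    have "(\<Sum>k=2..x. ln (real p) * (1 / real p) ^ k) = ln (real p) * (\<Sum>k=2..x. (1 / real p) ^ k)"
      by (simp add: sum_distrib_left)
    also have "\<dots> \<le> ln (real p) * (2 * (1 / real p)\<^sup>2)"
      using p by (intro mult_left_mono sum_power_from_2_le) (auto simp: field_simps)
    finally show "(\<Sum>k=2..x. ln (real p) * (1 / real p) ^ k) \<le> 2 * (ln (real p) / (real p)\<^sup>2)"
      by (simp add: power_divide mult.commute)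
  qed
  also have "\<dots> \<le> 2 * ln_sq_const"
    unfolding sum_distrib_left[symmetric] by (intro mult_left_mono sum_ln_over_square_le) auto
  finally show ?thesis by (simp add: f_def)
qed

lemma mertens_first:
  assumes "x \<ge> 1"
  shows "\<bar>(\<Sum>n=1..x. prime_log n * ln (real n)) - ln (real x)\<bar> \<le> 3 + 2 * ln_sq_const"
proof -
  define P where "P = {n\<in>{1..x}. prime n}"
  have P: "finite P" "\<And>n. n \<in> P \<Longrightarrow> prime n" "\<And>n. n \<in> P \<Longrightarrow> ln (real n) \<ge> 0"
    by (auto simp: P_def)
  have eq: "(\<Sum>n=1..x. prime_log n * ln (real n)) = (\<Sum>n\<in>P. prime_log n * ln (real n))"
    by (intro sum.mono_neutral_right) (auto simp: P_def prime_log_def)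
  have split: "(\<Sum>n=1..x. mangoldt n / real n) = (\<Sum>n\<in>P. ln (real n) / real n) +
                (\<Sum>n\<in>{n\<in>{1..x}. \<not>prime n}. mangoldt n / real n)"
  proof -
    have "(\<Sum>n=1..x. mangoldt n / real n) = (\<Sum>n\<in>P. mangoldt n / real n) +
                (\<Sum>n\<in>{n\<in>{1..x}. \<not>prime n}. mangoldt n / real n :: real)"
      by (subst sum.union_disjoint[symmetric]) (auto simp: P_def intro!: sum.cong)
    also have "(\<Sum>n\<in>P. mangoldt n / real n) = (\<Sum>n\<in>P. ln (real n) / real n)"
      by (intro sum.cong) (auto simp: P_def)
    finally show ?thesis .
  qed
  have nn: "0 \<le> (\<Sum>n\<in>{n\<in>{1..x}. \<not>prime n}. mangoldt n / real n :: real)"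
    by (intro sum_nonneg) (auto simp: mangoldt_nonneg)
  have lower: "(\<Sum>n\<in>P. ln (real n) / real n) \<le> (\<Sum>n\<in>P. prime_log n * ln (real n))"
    using mult_right_mono[OF prime_log_bounds(1)] P by (intro sum_mono) fastforce
  have "(\<Sum>n\<in>P. prime_log n * ln (real n)) \<le> (\<Sum>n\<in>P. ln (real n) / real n + 2 * (ln (real n) / (real n)\<^sup>2))"
    using mult_right_mono[OF prime_log_bounds(2)] P
    by (intro sum_mono) (fastforce simp: distrib_right)
  also have "\<dots> \<le> (\<Sum>n\<in>P. ln (real n) / real n) + 2 * ln_sq_const"
    unfolding sum.distrib sum_distrib_left[symmetric]
    by (intro add_left_mono mult_left_mono sum_ln_over_square_le P) auto
  finally have upper: "(\<Sum>n\<in>P. prime_log n * ln (real n)) \<le> (\<Sum>n\<in>P. ln (real n) / real n) + 2 * ln_sq_const" .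
  show ?thesis
    using eq split nn lower upper sum_mangoldt_nonprime_le[of x] ln_sq_const_nonneg
      sum_mangoldt_over_id_bounds[OF assms] by linarith
qed

section \<open>Partial summation and Mertens' second theorem\<close>

lemma abel_summation_bound:
  fixes e f :: "nat \<Rightarrow> real"
  assumes e: "\<And>k. m \<le> k \<Longrightarrow> \<bar>\<Sum>i=m..k. e i\<bar> \<le> B"
  assumes f: "\<And>k. m \<le> k \<Longrightarrow> f (Suc k) \<le> f k" "\<And>k. m \<le> k \<Longrightarrow> f k \<ge> 0"
  assumes "m \<le> n"
  shows "\<bar>\<Sum>k=m..n. e k * f k\<bar> \<le> B * f m"
proof -
  \<comment> \<open>Summation by parts: with the boundary term moved to the left, the induction adds
    up the decrements of f, and these telescope.\<close>
  have "\<bar>(\<Sum>k=m..n. e k * f k) - (\<Sum>i=m..n. e i) * f n\<bar> \<le> B * (f m - f n)"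
    using \<open>m \<le> n\<close>
  proof (induction n rule: dec_induct)
    case (step n)
    have "\<bar>(\<Sum>i=m..n. e i) * (f n - f (Suc n))\<bar> \<le> B * (f n - f (Suc n))"
      unfolding abs_mult using step e[of n] f[of n] by (intro mult_mono) auto
    moreover have "(\<Sum>k=m..Suc n. e k * f k) - (\<Sum>i=m..Suc n. e i) * f (Suc n) =
      ((\<Sum>k=m..n. e k * f k) - (\<Sum>i=m..n. e i) * f n) + (\<Sum>i=m..n. e i) * (f n - f (Suc n))"
      using step by (simp add: algebra_simps)
    ultimately show ?case using step.IH by (simp add: right_diff_distrib)
  qed simp
  moreover have "\<bar>(\<Sum>i=m..n. e i) * f n\<bar> \<le> B * f n"
    unfolding abs_mult using \<open>m \<le> n\<close> e[of n] f[of n] by (intro mult_mono) auto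
  ultimately show ?thesis by (simp add: right_diff_distrib)
qed

lemma ln_ratio_bounds:
  fixes a b :: real
  assumes "0 < b" "b \<le> a"
  shows "(a - b) / a \<le> ln a - ln b" "ln a - ln b \<le> (a - b) / b"
proof -
  show "ln a - ln b \<le> (a - b) / b" using ln_diff_le[of a b] assms by simp
  show "(a - b) / a \<le> ln a - ln b" using ln_diff_le[of b a] assms by (simp add: field_simps)
qed

lemma sum_telescope_Suc:
  fixes f :: "nat \<Rightarrow> real"
  shows "m \<le> n \<Longrightarrow> (\<Sum>k=Suc m..n. f k - f (k - 1)) = f n - f m"
  by (induction n rule: dec_induct) auto

text \<open>Twice the error in Mertens' first theorem, because a sum over a block is a difference of
  two initial sums.\<close>

definition mertens_B :: real where "mertens_B = 2 * (3 + 2 * ln_sq_const)"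

lemma mertens_B_pos: "mertens_B > 0"
  using ln_sq_const_nonneg by (simp add: mertens_B_def)

lemma mertens_first_increment:
  assumes "1 \<le> x" "x \<le> k"
  shows "\<bar>\<Sum>i=Suc x..k. prime_log i * ln (real i) - (ln (real i) - ln (real (i - 1)))\<bar> \<le> mertens_B"
proof -
  have "(\<Sum>i=1..k. prime_log i * ln (real i)) =
        (\<Sum>i=1..x. prime_log i * ln (real i)) + (\<Sum>i=Suc x..k. prime_log i * ln (real i))"
    using assms sum.ub_add_nat[of 1 x "\<lambda>i. prime_log i * ln (real i)" "k - x"] by simp
  moreover have "(\<Sum>i=Suc x..k. ln (real i) - ln (real (i - 1))) = ln (real k) - ln (real x)"
    using sum_telescope_Suc[of x k "\<lambda>i. ln (real i)"] assms by simp
  ultimately show ?thesis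
    using mertens_first[of x] mertens_first[of k] assms by (simp add: sum_subtractf mertens_B_def)
qed

definition prime_log_sum :: "nat \<Rightarrow> real" where
  "prime_log_sum n = (\<Sum>k=2..n. prime_log k)"

text \<open>Split \<open>prime_log k\<close> as (\<open>prime_log k * ln k - l k\<close>) / ln k +
  \<open>l k\<close> / ln k, where \<open>l k\<close> is the increment of ln. The first part has
  bounded partial sums before division by ln k, so Abel's inequality applies. The second is a
  Riemann sum for ln ln, with an error bounded by the telescoping differences of 1 / ln.\<close>

lemma mertens_second_cauchy:
  assumes x: "2 \<le> x" "x \<le> y"
  shows "\<bar>(prime_log_sum y - ln (ln (real y))) - (prime_log_sum x - ln (ln (real x)))\<bar>
           \<le> (mertens_B + 1) / ln (real x)"
proof -
  define l where "l = (\<lambda>k. ln (real k) - ln (real (k - 1)))"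
  have lnx: "ln (real x) > 0" using x by simp
  have inc: "prime_log_sum y = prime_log_sum x + (\<Sum>k=Suc x..y. prime_log k)"
    using assms sum.ub_add_nat[of 2 x prime_log "y - x"] by (simp add: prime_log_sum_def)
  have lnk: "ln (real (k - 1)) > 0" "ln (real k) \<ge> ln (real (k - 1))" "l k \<ge> 0" "l k \<le> 1"
            "ln (real k) > 0" if "k > x" for k
  proof -
    show *: "ln (real (k - 1)) > 0" and **: "ln (real k) \<ge> ln (real (k - 1))" using that x by auto
    thus "l k \<ge> 0" "ln (real k) > 0" by (auto simp: l_def)
    have "l k \<le> (real k - real (k - 1)) / real (k - 1)"
      unfolding l_def using that x by (intro ln_ratio_bounds) auto
    also have "\<dots> \<le> 1" using that x by (simp add: of_nat_diff)
    finally show "l k \<le> 1" .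
  qed
  have A: "\<bar>(\<Sum>k=Suc x..y. (prime_log k * ln (real k) - l k) * (1 / ln (real k)))\<bar> \<le> mertens_B / ln (real x)"
  proof (cases "x = y")
    case False
    have "\<bar>(\<Sum>k=Suc x..y. (prime_log k * ln (real k) - l k) * (1 / ln (real k)))\<bar>
            \<le> mertens_B * (1 / ln (real (Suc x)))"
    proof (rule abel_summation_bound)
      show "\<bar>\<Sum>i=Suc x..k. prime_log i * ln (real i) - l i\<bar> \<le> mertens_B" if "Suc x \<le> k" for k
        unfolding l_def using that x by (intro mertens_first_increment) auto
    qed (use x False in \<open>auto intro!: frac_le\<close>)
    also have "\<dots> \<le> mertens_B * (1 / ln (real x))"
      using x lnx mertens_B_pos by (intro mult_left_mono frac_le) auto
    finally show ?thesis by simp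
  qed (use lnx mertens_B_pos in auto)
  have eq: "(\<Sum>k=Suc x..y. prime_log k) = (\<Sum>k=Suc x..y. (prime_log k * ln (real k) - l k) * (1 / ln (real k)))
             + (\<Sum>k=Suc x..y. l k / ln (real k))"
    unfolding sum.distrib[symmetric]
  proof (intro sum.cong refl)
    fix k assume "k \<in> {Suc x..y}"
    thus "prime_log k = (prime_log k * ln (real k) - l k) * (1 / ln (real k)) + l k / ln (real k)"
      using lnk(5)[of k] by (simp add: field_simps)
  qed
  have tel: "(\<Sum>k=Suc x..y. ln (ln (real k)) - ln (ln (real (k - 1)))) = ln (ln (real y)) - ln (ln (real x))"
    using sum_telescope_Suc[of x y "\<lambda>k. ln (ln (real k))"] x by simp
  have B1: "(\<Sum>k=Suc x..y. l k / ln (real k)) \<le> ln (ln (real y)) - ln (ln (real x))"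
    unfolding tel[symmetric] l_def using lnk by (intro sum_mono ln_ratio_bounds) auto
  have "ln (ln (real y)) - ln (ln (real x)) - (\<Sum>k=Suc x..y. l k / ln (real k))
          \<le> (\<Sum>k=Suc x..y. (- 1 / ln (real k)) - (- 1 / ln (real (k - 1))))"
    unfolding tel[symmetric] sum_subtractf[symmetric]
  proof (intro sum_mono)
    fix k assume k: "k \<in> {Suc x..y}"
    have *: "1 / ln (real (k - 1)) - 1 / ln (real k) \<ge> 0"
      using lnk[of k] k by (simp add: frac_le)
    have "ln (ln (real k)) - ln (ln (real (k - 1))) \<le> l k / ln (real (k - 1))"
      unfolding l_def using lnk[of k] k by (intro ln_ratio_bounds) auto
    hence "ln (ln (real k)) - ln (ln (real (k - 1))) - l k / ln (real k) \<le>
             l k * (1 / ln (real (k - 1)) - 1 / ln (real k))"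
      by (simp add: algebra_simps)
    also have "\<dots> \<le> 1 * (1 / ln (real (k - 1)) - 1 / ln (real k))"
      using lnk[of k] k * by (intro mult_right_mono) auto
    finally show "ln (ln (real k)) - ln (ln (real (k - 1))) - l k / ln (real k) \<le>
       (- 1 / ln (real k)) - (- 1 / ln (real (k - 1)))" by simp
  qed
  also have "\<dots> = 1 / ln (real x) - 1 / ln (real y)"
    using sum_telescope_Suc[of x y "\<lambda>k. - 1 / ln (real k)"] x by simp
  also have "\<dots> \<le> 1 / ln (real x)" using x by simp
  finally show ?thesis using A B1 inc eq by (simp add: add_divide_distrib)
qed

text \<open>Letting y tend to infinity in the Cauchy estimate preserves its rate. Only the existence
  of the limit is obtained here; its value needs the zeta function near 1.\<close>

lemma mertens_second:
  obtains c where "\<And>x. 2 \<le> x \<Longrightarrow>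
    \<bar>prime_log_sum x - ln (ln (real x)) - c\<bar> \<le> (mertens_B + 1) / ln (real x)"
proof -
  define D where "D = (\<lambda>x. prime_log_sum x - ln (ln (real x)))"
  have lim0: "(\<lambda>x. (mertens_B + 1) / ln (real x)) \<longlonglongrightarrow> 0" by real_asymp
  have "Cauchy D"
  proof (rule metric_CauchyI)
    fix e :: real assume "e > 0"
    hence "eventually (\<lambda>x. (mertens_B + 1) / ln (real x) < e / 2) sequentially"
      using lim0 by (intro order_tendstoD(2)[OF lim0]) auto
    then obtain M where M: "M \<ge> 2" "(mertens_B + 1) / ln (real M) < e / 2"
      unfolding eventually_sequentially by (metis nat_le_linear)
    have *: "\<bar>D n - D M\<bar> < e / 2" if "n \<ge> M" for n
      using mertens_second_cauchy[of M n] M that unfolding D_def by linarith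
    show "\<exists>M. \<forall>m\<ge>M. \<forall>n\<ge>M. dist (D m) (D n) < e"
    proof (intro exI[of _ M] allI impI)
      fix m n assume "m \<ge> M" "n \<ge> M"
      thus "dist (D m) (D n) < e" using *[of m] *[of n] unfolding dist_real_def by linarith
    qed
  qed
  then obtain c where c: "D \<longlonglongrightarrow> c" using real_Cauchy_convergent convergent_def by blast
  show ?thesis
  proof (rule that[of c])
    fix x :: nat assume x: "2 \<le> x"
    have "(\<lambda>y. \<bar>D y - D x\<bar>) \<longlonglongrightarrow> \<bar>c - D x\<bar>" by (intro tendsto_intros c)
    moreover have "eventually (\<lambda>y. \<bar>D y - D x\<bar> \<le> (mertens_B + 1) / ln (real x)) sequentially"
      using eventually_ge_at_top[of x]
      by eventually_elim (use x mertens_second_cauchy[of x] in \<open>auto simp: D_def\<close>)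
    ultimately have "\<bar>c - D x\<bar> \<le> (mertens_B + 1) / ln (real x)"
      by (intro tendsto_upperbound) auto
    thus "\<bar>prime_log_sum x - ln (ln (real x)) - c\<bar> \<le> (mertens_B + 1) / ln (real x)"
      by (simp add: D_def abs_minus_commute)
  qed
qed

text \<open>In essence the convergence of the sum of 1 / (p ln p), on which the bounded mean of p(n)
  s(n) / n rests. Partial summation runs against 1 / (ln k)^2 this time, and the smooth part is
  dominated by differences of 1 / ln.\<close>

lemma sum_prime_log_over_ln_bounded:
  obtains K where "\<And>n. (\<Sum>k=2..n. prime_log k / ln (real k)) \<le> K"
proof -
  define l where "l = (\<lambda>k. ln (real k) - ln (real (k - 1)))"
  define K where "K = prime_log 2 / ln 2 + mertens_B * (1 / (ln 3)\<^sup>2) + 1 / ln 2"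
  have "(\<Sum>k=2..n. prime_log k / ln (real k)) \<le> K" for n
  proof -
    have K0: "K \<ge> 0" "prime_log 2 / ln 2 \<le> K"
      using prime_log_nonneg[of 2] mertens_B_pos by (auto simp: K_def)
    consider "n < 2" | "n = 2" | "n \<ge> 3" by linarith
    thus ?thesis
    proof cases
      case 3
      have lnk: "ln (real (k - 1)) > 0" "ln (real k) \<ge> ln (real (k - 1))" "ln (real k) > 0" if "k \<ge> 3" for k
        using that by auto
      \<comment> \<open>The term k = 2 is split off because the comparison divides by ln (k - 1),
        which vanishes there.\<close>
      have "(\<Sum>k=2..n. prime_log k / ln (real k)) = prime_log 2 / ln 2 + (\<Sum>k=3..n. prime_log k / ln (real k))"
        using 3 by (subst sum.atLeast_Suc_atMost) (auto simp: eval_nat_numeral)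
      also have "(\<Sum>k=3..n. prime_log k / ln (real k)) =
         (\<Sum>k=3..n. (prime_log k * ln (real k) - l k) * (1 / (ln (real k))\<^sup>2)) + (\<Sum>k=3..n. l k / (ln (real k))\<^sup>2)"
        unfolding sum.distrib[symmetric]
      proof (intro sum.cong refl)
        fix k assume "k \<in> {3..n}"
        thus "prime_log k / ln (real k) = (prime_log k * ln (real k) - l k) * (1 / (ln (real k))\<^sup>2) + l k / (ln (real k))\<^sup>2"
          using lnk(3)[of k] by (simp add: field_simps power2_eq_square)
      qed
      also have "(\<Sum>k=3..n. (prime_log k * ln (real k) - l k) * (1 / (ln (real k))\<^sup>2)) \<le> mertens_B * (1 / (ln (real 3))\<^sup>2)"
      proof (rule order_trans[OF abs_ge_self], rule abel_summation_bound)
        show "\<bar>\<Sum>i=3..k. prime_log i * ln (real i) - l i\<bar> \<le> mertens_B" if "3 \<le> k" for k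
          using mertens_first_increment[of 2 k] that by (simp add: l_def)
      qed (use 3 in \<open>auto intro!: frac_le power_mono\<close>)
      also have "(\<Sum>k=3..n. l k / (ln (real k))\<^sup>2) \<le> (\<Sum>k=3..n. (- 1 / ln (real k)) - (- 1 / ln (real (k - 1))))"
      proof (intro sum_mono)
        fix k assume k: "k \<in> {3..n}"
        have "l k / (ln (real k))\<^sup>2 \<le> l k / (ln (real (k - 1)) * ln (real k))"
          unfolding power2_eq_square using lnk[of k] k by (intro divide_left_mono mult_right_mono) (auto simp: l_def)
        also have "\<dots> = (- 1 / ln (real k)) - (- 1 / ln (real (k - 1)))"
          using lnk[of k] k by (simp add: l_def field_simps)
        finally show "l k / (ln (real k))\<^sup>2 \<le> (- 1 / ln (real k)) - (- 1 / ln (real (k - 1)))" .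
      qed
      also have "\<dots> = 1 / ln 2 - 1 / ln (real n)"
        using sum_telescope_Suc[of 2 n "\<lambda>k. - 1 / ln (real k)"] 3 by simp
      also have "\<dots> \<le> 1 / ln 2" using 3 by simp
      finally show ?thesis by (simp add: K_def)
    qed (use K0 in auto)
  qed
  thus ?thesis using that by blast
qed

subsection \<open>Rough numbers and the Euler product\<close>

text \<open>The inequality is weak, so that for n \<ge> 2 the condition is equivalent to j \<le>
  \<open>lpf n\<close> and the step from p to \<open>Suc p\<close> removes exactly the multiples of
  p. The number 1 is rough at every level, 0 at none.\<close>

definition rough :: "nat \<Rightarrow> nat \<Rightarrow> bool" where
  "rough j m \<longleftrightarrow> m > 0 \<and> (\<forall>p. prime p \<longrightarrow> p dvd m \<longrightarrow> j \<le> p)"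

lemma rough_1 [simp]: "rough j (Suc 0)"
  by (auto simp: rough_def)

lemma rough_pos: "rough j m \<Longrightarrow> m > 0"
  by (simp add: rough_def)

lemma rough_le_2: "j \<le> 2 \<Longrightarrow> rough j m \<longleftrightarrow> m > 0"
  using prime_ge_2_nat by (auto simp: rough_def intro: order_trans)

lemma rough_mult_iff: "rough j (a * b) \<longleftrightarrow> rough j a \<and> rough j b"
  by (auto simp: rough_def prime_dvd_mult_iff)

lemma rough_prime_iff: "prime p \<Longrightarrow> rough j p \<longleftrightarrow> j \<le> p"
  by (auto simp: rough_def prime_gt_0_nat dest: primes_dvd_imp_eq)

lemma rough_Suc_iff: "rough (Suc j) m \<longleftrightarrow> rough j m \<and> \<not>(prime j \<and> j dvd m)"
  unfolding rough_def by (metis Suc_leD Suc_leI le_neq_implies_less not_less_eq_eq order_refl)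

lemma rough_ge:
  assumes "rough j m" "m \<noteq> 1"
  shows "j \<le> m"
proof -
  obtain p where "prime p" "p dvd m" using assms prime_factor_nat by blast
  thus ?thesis using assms dvd_imp_le[of p m] by (auto simp: rough_def)
qed

text \<open>A p-rough multiple of p is p times a p-rough number. This one decomposition yields both
  the Euler product, by summing n^(-s) over it, and Legendre's recursion, by counting.\<close>

lemma rough_set_split:
  assumes "prime p"
  shows "{m. rough p m} = {m. rough (Suc p) m} \<union> (*) p ` {m. rough p m}"
        "{m. rough (Suc p) m} \<inter> (*) p ` {m. rough p m} = {}"
proof -
  show "{m. rough p m} = {m. rough (Suc p) m} \<union> (*) p ` {m. rough p m}"
  proof (intro equalityI subsetI)
    fix m assume m: "m \<in> {m. rough p m}"
    show "m \<in> {m. rough (Suc p) m} \<union> (*) p ` {m. rough p m}"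
    proof (cases "p dvd m")
      case True
      then obtain k where "m = p * k" by blast
      thus ?thesis using m by (auto simp: rough_mult_iff)
    qed (use m in \<open>auto simp: rough_Suc_iff\<close>)
  qed (use assms in \<open>auto simp: rough_Suc_iff rough_mult_iff rough_prime_iff\<close>)
qed (use assms in \<open>auto simp: rough_Suc_iff\<close>)

lemma rough_set_Suc_nonprime: "\<not>prime j \<Longrightarrow> {m. rough (Suc j) m} = {m. rough j m}"
  by (auto simp: rough_Suc_iff)

section \<open>The Euler product for real s > 1\<close>

context
  fixes s :: real
  assumes s: "s > 1"
begin

lemma summable_powr: "summable (\<lambda>n. real n powr (-s))"
  using s by (simp add: summable_real_powr_iff)

lemma powr_summable_on: "(\<lambda>n. real n powr (-s)) summable_on A"
proof (rule summable_on_subset_banach)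
  show "(\<lambda>n. real n powr (-s)) summable_on UNIV"
    using sums_nonneg_imp_has_sum[OF summable_sums[OF summable_powr]]
    by (auto simp: summable_on_def)
qed auto

lemma infsum_rough_Suc:
  "infsum (\<lambda>n. real n powr (-s)) {m. rough (Suc j) m} =
     (if prime j then 1 - real j powr (-s) else 1) * infsum (\<lambda>n. real n powr (-s)) {m. rough j m}"
proof (cases "prime j")
  case True
  have "infsum (\<lambda>n. real n powr (-s)) {m. rough j m} =
        infsum (\<lambda>n. real n powr (-s)) {m. rough (Suc j) m} +
        infsum (\<lambda>n. real n powr (-s)) ((*) j ` {m. rough j m})"
    by (subst rough_set_split(1)[OF True], rule infsum_Un_disjoint)
       (use rough_set_split(2)[OF True] in \<open>auto intro: powr_summable_on\<close>)
  also have "infsum (\<lambda>n. real n powr (-s)) ((*) j ` {m. rough j m}) =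
             infsum (\<lambda>n. real j powr (-s) * real n powr (-s)) {m. rough j m}"
    using True by (subst infsum_reindex) (auto simp: inj_on_def powr_mult o_def)
  also have "\<dots> = real j powr (-s) * infsum (\<lambda>n. real n powr (-s)) {m. rough j m}"
    by (rule infsum_cmult_right')
  finally show ?thesis using True by (simp add: algebra_simps)
qed (simp add: rough_set_Suc_nonprime)

text \<open>Apart from 1, every j-rough number is at least j, so the rest is bounded by a tail of a
  convergent series.\<close>

lemma infsum_rough_LIMSEQ:
  "(\<lambda>j. infsum (\<lambda>n. real n powr (-s)) {m. rough j m}) \<longlonglongrightarrow> 1"
proof (rule tendsto_sandwich)
  let ?f = "\<lambda>n. real n powr (-s)"
  have "infsum ?f {1} \<le> infsum ?f {m. rough j m}" for j
    by (intro infsum_mono2 powr_summable_on) auto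
  thus "\<forall>\<^sub>F j in sequentially. 1 \<le> infsum ?f {m. rough j m}" by simp
  have "infsum ?f {m. rough j m} \<le> 1 + (suminf ?f - (\<Sum>n<j. ?f n))" for j
  proof -
    have "infsum ?f {m. rough j m} \<le> infsum ?f ({1} \<union> ({j..} - {1}))"
      using rough_ge by (intro infsum_mono2 powr_summable_on) auto
    also have "\<dots> = infsum ?f {1} + infsum ?f ({j..} - {1})"
      by (intro infsum_Un_disjoint powr_summable_on) auto
    also have "infsum ?f ({j..} - {1}) \<le> infsum ?f {j..}"
      by (intro infsum_mono2 powr_summable_on) auto
    also have "infsum ?f UNIV = infsum ?f ({..<j} \<union> {j..})" by (rule arg_cong) auto
    hence "infsum ?f {j..} = infsum ?f UNIV - (\<Sum>n<j. ?f n)"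
      by (subst (asm) infsum_Un_disjoint) (auto intro: powr_summable_on)
    also have "infsum ?f UNIV = suminf ?f"
      using sums_nonneg_imp_has_sum[OF summable_sums[OF summable_powr]] infsumI by auto
    finally show ?thesis by simp
  qed
  thus "\<forall>\<^sub>F j in sequentially. infsum ?f {m. rough j m} \<le> 1 + (suminf ?f - (\<Sum>n<j. ?f n))"
    by simp
  have "(\<lambda>j. 1 + (suminf ?f - (\<Sum>n<j. ?f n))) \<longlonglongrightarrow> 1 + (suminf ?f - suminf ?f)"
    by (intro tendsto_intros summable_LIMSEQ summable_powr)
  thus "(\<lambda>j. 1 + (suminf ?f - (\<Sum>n<j. ?f n))) \<longlonglongrightarrow> 1" by simp
qed auto

lemma euler_product_log:
  "(\<lambda>n. \<Sum>k=2..n. if prime k then - ln (1 - real k powr (-s)) else 0) \<longlonglongrightarrow>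
     ln (\<Sum>n. real n powr (-s))"
proof -
  define z where "z = (\<lambda>k. if prime k then - ln (1 - real k powr (-s)) else 0)"
  define I where "I = (\<lambda>j. infsum (\<lambda>n. real n powr (-s)) {m. rough j m})"
  have Ipos: "I j > 0" for j
  proof -
    have "infsum (\<lambda>n. real n powr (-s)) {1} \<le> I j"
      unfolding I_def by (intro infsum_mono2 powr_summable_on) auto
    thus ?thesis by simp
  qed
  have I2: "I 2 = (\<Sum>n. real n powr (-s))"
  proof -
    \<comment> \<open>The two index sets differ only in 0, where \<open>0 powr (-s)\<close> is
      0.\<close>
    have "I 2 = infsum (\<lambda>n. real n powr (-s)) UNIV"
      unfolding I_def by (rule infsum_cong_neutral) (auto simp: rough_le_2)
    thus ?thesis
      using sums_nonneg_imp_has_sum[OF summable_sums[OF summable_powr]] infsumI by auto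
  qed
  have lnI: "(\<Sum>k=2..n. z k) = ln (I 2) - ln (I (Suc n))" if "n \<ge> 1" for n
    using that
  proof (induction n rule: dec_induct)
    case (step n)
    have "ln (I (Suc (Suc n))) = ln (I (Suc n)) - z (Suc n)"
    proof (cases "prime (Suc n)")
      case True
      have "real (Suc n) powr (-s) < 1" using True prime_gt_1_nat[OF True] s
        by (intro powr_less_one) auto
      thus ?thesis using Ipos[of "Suc n"] True
        unfolding I_def infsum_rough_Suc[of "Suc n"] z_def by (subst ln_mult) auto
    qed (simp add: I_def infsum_rough_Suc[of "Suc n"] z_def)
    thus ?case using step by simp
  qed (simp add: numeral_2_eq_2)
  have "(\<lambda>n. ln (I 2) - ln (I (Suc n))) \<longlonglongrightarrow> ln (I 2) - ln 1"
    using LIMSEQ_Suc[OF infsum_rough_LIMSEQ] unfolding I_def by (intro tendsto_intros) auto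
  moreover have "eventually (\<lambda>n. ln (I 2) - ln (I (Suc n)) = (\<Sum>k=2..n. z k)) sequentially"
    using eventually_ge_at_top[of 1] by eventually_elim (use lnI in auto)
  ultimately have "(\<lambda>n. \<Sum>k=2..n. z k) \<longlonglongrightarrow> ln (I 2)"
    by (simp add: tendsto_cong)
  thus ?thesis by (simp add: I2 z_def)
qed

end

text \<open>By the mean value theorem the decrement of n^(-d) lies between d (n+1)^(-1-d) and d
  n^(-1-d), and the decrements telescope to 1. These bounds locate the pole of the zeta function at
  1 precisely enough for its logarithm.\<close>

lemma zeta_real_bounds:
  fixes d :: real
  assumes d: "d > 0"
  shows "1 / d \<le> (\<Sum>n. real n powr (-(1 + d)))" "(\<Sum>n. real n powr (-(1 + d))) \<le> 1 + 1 / d"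
proof -
  let ?f = "\<lambda>n. real n powr (-(1 + d))"
  let ?g = "\<lambda>n. real (Suc n) powr (-d) - real (Suc (Suc n)) powr (-d)"
  have sm: "summable ?f" using d by (intro summable_powr) auto
  have "(\<lambda>n. real (Suc n) powr (-d)) \<longlonglongrightarrow> 0" using d by real_asymp
  from telescope_sums'[OF this] have g: "?g sums 1" by simp
  have diff: "d * ?f (Suc (Suc n)) \<le> ?g n" "?g n \<le> d * ?f (Suc n)" for n
  proof -
    have "\<exists>z. real (Suc n) < z \<and> z < real (Suc (Suc n)) \<and>
        real (Suc (Suc n)) powr (-d) - real (Suc n) powr (-d) =
        (real (Suc (Suc n)) - real (Suc n)) * ((-d) * z powr (-d - 1))"
      by (intro MVT2) (auto intro!: derivative_eq_intros)
    then obtain z where z: "real (Suc n) < z" "z < real (Suc (Suc n))" "?g n = d * z powr (-d - 1)"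
      by auto
    have e: "-(1 + d) = -d - 1" by simp
    have "real (Suc (Suc n)) powr (-d - 1) \<le> z powr (-d - 1)"
      using z(1,2) d by (intro powr_mono2') auto
    moreover have "z powr (-d - 1) \<le> real (Suc n) powr (-d - 1)"
      using z(1,2) d by (intro powr_mono2') auto
    ultimately show "d * ?f (Suc (Suc n)) \<le> ?g n" "?g n \<le> d * ?f (Suc n)"
      unfolding z(3) e using d by (auto intro!: mult_left_mono)
  qed
  have s1: "(\<lambda>n. ?f (Suc n)) sums suminf ?f"
    using summable_sums[OF sm] sums_Suc_iff[of ?f] by simp
  have s2: "(\<lambda>n. ?f (Suc (Suc n))) sums (suminf ?f - 1)"
    using s1 sums_Suc_iff[of "\<lambda>n. ?f (Suc n)"] by simp
  have "1 \<le> d * suminf ?f"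
    using sums_le[OF diff(2) g sums_mult[OF s1]] by simp
  thus "1 / d \<le> suminf ?f" using d by (simp add: field_simps)
  have "d * (suminf ?f - 1) \<le> 1"
    using sums_le[OF diff(1) sums_mult[OF s2] g] by simp
  thus "suminf ?f \<le> 1 + 1 / d" using d by (simp add: field_simps)
qed

text \<open>The Euler product involves - ln (1 - p^(-1-d)), partial summation involves
  \<open>prime_log p\<close> times p^(-d). Their difference must carry a factor d in order to vanish
  in the limit, as well as a convergent weight in p.\<close>

lemma prime_log_twist:
  assumes "prime p" "d > 0"
  shows "\<bar>prime_log p * real p powr (-d) - (- ln (1 - real p powr (-(1 + d))))\<bar>
           \<le> 2 * d * (ln (real p) / (real p)\<^sup>2)"
proof -
  define u where "u = 1 / real p"
  define t where "t = real p powr (-d)"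
  have p2: "real p \<ge> 2" using prime_ge_2_nat[OF assms(1)] by simp
  have u: "0 < u" "u \<le> 1/2" using p2 by (auto simp: u_def field_simps)
  have t: "0 < t" "t < 1" using p2 assms by (auto simp: t_def intro: powr_less_one)
  have tu: "real p powr (-(1 + d)) = t * u" using p2
    by (simp add: t_def u_def powr_diff powr_minus field_simps powr_add)
  \<comment> \<open>With u = 1/p, the difference to be bounded is \<phi> at t = p^(-d), and \<phi>
    vanishes at 1. The mean value theorem thus gives 1 - t \<le> d ln p times a derivative of size
    at most 2 u^2.\<close>
  define \<phi> where "\<phi> = (\<lambda>x. x * (- ln (1 - u)) + ln (1 - x * u))"
  have pos: "x * u \<le> 1/2" "x * u \<ge> 0" if "0 \<le> x" "x \<le> 1" for x
    using mult_mono[of x 1 u "1/2"] that u by auto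
  have "\<exists>z. t < z \<and> z < 1 \<and> \<phi> 1 - \<phi> t = (1 - t) * (- ln (1 - u) - u / (1 - z * u))"
  proof (intro MVT2)
    fix x assume "t \<le> x" "x \<le> 1"
    hence "x * u < 1" using pos[of x] t by simp
    hence "((\<lambda>x. x * (- ln (1 - u)) + ln (1 - x * u)) has_real_derivative
             (1 * (- ln (1 - u)) + 1 / (1 - x * u) * (0 - 1 * u))) (at x)"
      by (intro DERIV_add DERIV_cmult_right DERIV_ident DERIV_chain2[where f = ln] DERIV_ln_divide
            DERIV_diff DERIV_const) simp
    thus "DERIV \<phi> x :> - ln (1 - u) - u / (1 - x * u)" unfolding \<phi>_def by simp
  qed (use t in auto)
  then obtain z where z: "t < z" "z < 1" "\<phi> 1 - \<phi> t = (1 - t) * (- ln (1 - u) - u / (1 - z * u))"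
    by auto
  have zu: "z * u \<le> 1/2" "z * u \<ge> 0" "z * u \<le> u" using pos[of z] z t u by auto
  have "u / (1 - z * u) \<ge> u" using zu u by (simp add: field_simps)
  moreover have "u / (1 - z * u) \<le> u / (1 - u)" using zu u by (intro divide_left_mono mult_pos_pos) linarith+
  moreover have "u / (1 - u) \<le> u + 2 * u\<^sup>2"
  proof -
    have "0 \<le> u\<^sup>2 * (1 - 2 * u)" using u by simp
    hence "u \<le> (u + 2 * u\<^sup>2) * (1 - u)" by (simp add: algebra_simps power2_eq_square)
    thus ?thesis using u by (simp add: field_simps)
  qed
  ultimately have "\<bar>- ln (1 - u) - u / (1 - z * u)\<bar> \<le> 2 * u\<^sup>2"
    using neg_ln_one_minus_bounds[of u] u by linarith
  hence "\<bar>\<phi> 1 - \<phi> t\<bar> \<le> (1 - t) * (2 * u\<^sup>2)"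
    unfolding z(3) abs_mult using t by (intro mult_mono) auto
  also have "1 - t \<le> d * ln (real p)"
    using exp_ge_add_one_self[of "-d * ln (real p)"] p2 by (simp add: t_def powr_def)
  hence "(1 - t) * (2 * u\<^sup>2) \<le> d * ln (real p) * (2 * u\<^sup>2)" by (intro mult_right_mono) auto
  finally have "\<bar>\<phi> t\<bar> \<le> 2 * d * (ln (real p) * u\<^sup>2)" by (simp add: \<phi>_def mult_ac)
  moreover have "\<phi> t = prime_log p * real p powr (-d) - (- ln (1 - real p powr (-(1 + d))))"
    unfolding tu using assms by (simp add: \<phi>_def prime_log_def t_def u_def)
  moreover have "ln (real p) * u\<^sup>2 = ln (real p) / (real p)\<^sup>2"
    by (simp add: u_def power_divide)
  ultimately show ?thesis by simp
qed

text \<open>Abel's limit theorem with uniformity: M and C depend neither on r nor on n, so that n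
  may go to infinity before r tends to 1.\<close>

lemma abel_limit_finite:
  fixes b :: "nat \<Rightarrow> real"
  assumes lim: "(\<lambda>n. \<Sum>k=1..n. b k) \<longlonglongrightarrow> \<beta>" and "e > 0"
  obtains M C where "\<And>r n. 0 < r \<Longrightarrow> r < 1 \<Longrightarrow> n \<ge> M \<Longrightarrow>
    \<bar>(\<Sum>k=1..n. b k * r ^ k) - \<beta>\<bar> \<le> e + (1 - r) * C"
proof -
  define B where "B = (\<lambda>n. \<Sum>k=1..n. b k)"
  obtain M where M: "\<And>n. n \<ge> M \<Longrightarrow> \<bar>B n - \<beta>\<bar> < e"
    using LIMSEQ_D[OF lim \<open>e > 0\<close>] by (auto simp: B_def)
  define C where "C = (\<Sum>k<M. \<bar>B k - \<beta>\<bar>)"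
  have part: "(\<Sum>k=1..n. b k * r ^ k) - \<beta> = r ^ n * (B n - \<beta>) + (1 - r) * (\<Sum>k<n. (B k - \<beta>) * r ^ k)" for r n
  proof (induction n)
    case (Suc n)
    have "B (Suc n) = B n + b (Suc n)" by (simp add: B_def)
    thus ?case using Suc by (simp add: algebra_simps)
  qed (simp add: B_def)
  show ?thesis
  proof (rule that)
    fix r :: real and n assume r: "0 < r" "r < 1" and n: "n \<ge> M"
    have "\<bar>\<Sum>k<n. (B k - \<beta>) * r ^ k\<bar> \<le> (\<Sum>k<n. \<bar>B k - \<beta>\<bar> * r ^ k)"
      using r by (intro order_trans[OF sum_abs]) (simp add: abs_mult)
    also have "\<dots> \<le> (\<Sum>k<n. (if k < M then \<bar>B k - \<beta>\<bar> else 0) + e * r ^ k)"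
    proof (intro sum_mono)
      fix k
      show "\<bar>B k - \<beta>\<bar> * r ^ k \<le> (if k < M then \<bar>B k - \<beta>\<bar> else 0) + e * r ^ k"
      proof (cases "k < M")
        case True
        have "\<bar>B k - \<beta>\<bar> * r ^ k \<le> \<bar>B k - \<beta>\<bar> * 1" using r by (intro mult_left_mono power_le_one) auto
        thus ?thesis using True \<open>e > 0\<close> r by (simp add: add_increasing2)
      qed (use M[of k] r in \<open>auto intro!: mult_right_mono\<close>)
    qed
    also have "\<dots> = C + e * (\<Sum>k<n. r ^ k)"
    proof -
      have "(\<Sum>k<n. if k < M then \<bar>B k - \<beta>\<bar> else 0) = C"
        unfolding C_def using n by (intro sum.mono_neutral_cong_right) auto
      thus ?thesis by (simp add: sum.distrib sum_distrib_left)
    qed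
    finally have "(1 - r) * \<bar>\<Sum>k<n. (B k - \<beta>) * r ^ k\<bar> \<le> (1 - r) * (C + e * (\<Sum>k<n. r ^ k))"
      using r by (intro mult_left_mono) auto
    also have "\<dots> = (1 - r) * C + e * (1 - r ^ n)"
    proof -
      have "(1 - r) * (\<Sum>k<n. r ^ k) = 1 - r ^ n" using r by (simp add: sum_gp_strict)
      moreover have "(1 - r) * (C + e * (\<Sum>k<n. r ^ k)) = (1 - r) * C + e * ((1 - r) * (\<Sum>k<n. r ^ k))"
        by (simp add: algebra_simps)
      ultimately show ?thesis by simp
    qed
    finally have 1: "(1 - r) * \<bar>\<Sum>k<n. (B k - \<beta>) * r ^ k\<bar> \<le> (1 - r) * C + e * (1 - r ^ n)" .
    have 2: "r ^ n * \<bar>B n - \<beta>\<bar> \<le> r ^ n * e" using r M[OF n] by (intro mult_left_mono) auto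
    have "\<bar>(\<Sum>k=1..n. b k * r ^ k) - \<beta>\<bar> \<le> r ^ n * \<bar>B n - \<beta>\<bar> + (1 - r) * \<bar>\<Sum>k<n. (B k - \<beta>) * r ^ k\<bar>"
      unfolding part using r by (intro order_trans[OF abs_triangle_ineq]) (simp add: abs_mult)
    thus "\<bar>(\<Sum>k=1..n. b k * r ^ k) - \<beta>\<bar> \<le> e + (1 - r) * C"
      using 1 2 by (simp add: algebra_simps)
  qed
qed

subsection \<open>The constant in Mertens' theorem\<close>

text \<open>At these cuts ln ln is ln k up to o(1), so \<open>prime_log_sum\<close> can be compared
  with harmonic numbers. That is where \<gamma> enters.\<close>

definition exp_floor :: "nat \<Rightarrow> nat" where
  "exp_floor k = nat \<lfloor>exp (real k)\<rfloor>"

lemma exp_floor_0 [simp]: "exp_floor 0 = 1"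
  by (simp add: exp_floor_def)

lemma exp_floor_mono: "k \<le> l \<Longrightarrow> exp_floor k \<le> exp_floor l"
  unfolding exp_floor_def by (intro nat_mono floor_mono) auto

lemma exp_floor_ge_1: "exp_floor k \<ge> 1"
  using exp_floor_mono[of 0 k] by simp

lemma le_exp_floor_iff: "n \<le> exp_floor k \<longleftrightarrow> real n \<le> exp (real k)"
  unfolding exp_floor_def by (simp add: le_nat_iff le_floor_iff)

text \<open>Cutting the primes at the powers of \<open>e\<close> makes the Dirichlet series comparable with the
  power series of the logarithm at \<open>r = exp (-d)\<close>.\<close>

lemma prime_log_block_bounds:
  fixes d :: real
  assumes d: "d > 0"
  defines "r \<equiv> exp (-d)"
  defines "a \<equiv> (\<lambda>k. prime_log_sum (exp_floor k) - prime_log_sum (exp_floor (k - 1)))"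
  defines "G \<equiv> (\<lambda>K. \<Sum>n=2..exp_floor K. prime_log n * real n powr (-d))"
  shows "(\<Sum>k=1..K. a k * r ^ k) \<le> G K" "r * G K \<le> (\<Sum>k=1..K. a k * r ^ k)"
proof -
  have r: "0 < r" "r < 1" using d by (auto simp: r_def)
  have step: "a (Suc K) * r ^ Suc K \<le> G (Suc K) - G K" "G (Suc K) - G K \<le> a (Suc K) * r ^ K" for K
  proof -
    define A where "A = {Suc (exp_floor K)..exp_floor (Suc K)}"
    have le: "exp_floor K \<le> exp_floor (Suc K)" by (rule exp_floor_mono) simp
    have split: "(\<Sum>n=2..exp_floor (Suc K). f n) = (\<Sum>n=2..exp_floor K. f n) + sum f A" for f :: "nat \<Rightarrow> real"
      using sum.ub_add_nat[of 2 "exp_floor K" f "exp_floor (Suc K) - exp_floor K"] le exp_floor_ge_1[of K]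
      by (simp add: A_def)
    have a: "a (Suc K) = sum prime_log A"
      using split[of prime_log] by (simp add: a_def prime_log_sum_def)
    have G: "G (Suc K) - G K = (\<Sum>n\<in>A. prime_log n * real n powr (-d))"
      using split unfolding G_def by simp
    \<comment> \<open>Here exp K < n \<le> exp (K + 1). The two bounds differ by a factor r, which
      tends to 1 with d and is therefore harmless in the limit.\<close>
    have pw: "r ^ Suc K \<le> real n powr (-d)" "real n powr (-d) \<le> r ^ K" if "n \<in> A" for n
    proof -
      have n: "exp (real K) < real n" "real n \<le> exp (real (Suc K))"
        using that le_exp_floor_iff[of n K] le_exp_floor_iff[of n "Suc K"] by (auto simp: A_def)
      have rk: "r ^ k = exp (real k) powr (-d)" for k
        by (simp add: r_def powr_def exp_of_nat_mult[symmetric] mult_ac)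
      show "r ^ Suc K \<le> real n powr (-d)" unfolding rk
        using n d less_trans[OF exp_gt_zero n(1)] by (intro powr_mono2') auto
      show "real n powr (-d) \<le> r ^ K" unfolding rk
        using n d by (intro powr_mono2') auto
    qed
    show "a (Suc K) * r ^ Suc K \<le> G (Suc K) - G K"
      unfolding a G sum_distrib_right using pw prime_log_nonneg by (intro sum_mono mult_left_mono) auto
    show "G (Suc K) - G K \<le> a (Suc K) * r ^ K"
      unfolding a G sum_distrib_right using pw prime_log_nonneg by (intro sum_mono mult_left_mono) auto
  qed
  show "(\<Sum>k=1..K. a k * r ^ k) \<le> G K"
  proof (induction K)
    case (Suc K)
    thus ?case using step(1)[of K] by simp
  qed (simp add: G_def)
  show "r * G K \<le> (\<Sum>k=1..K. a k * r ^ k)"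
  proof (induction K)
    case (Suc K)
    have "r * (G (Suc K) - G K) \<le> r * (a (Suc K) * r ^ K)"
      using step(2)[of K] r by (intro mult_left_mono) auto
    thus ?case using Suc by (simp add: algebra_simps)
  qed (simp add: G_def)
qed

text \<open>Here c - \<gamma> is the sum of the numbers \<open>b k\<close>. Weighted by r^k with r =
  exp (-d), this sum becomes, up to vanishing errors, ln \<zeta>(1 + d) + ln (1 - r); both \<zeta>(1
  + d) and 1 / (1 - r) behave like 1/d, so the limit is 0.\<close>

lemma mertens_constant:
  assumes c: "\<And>x. 2 \<le> x \<Longrightarrow> \<bar>prime_log_sum x - ln (ln (real x)) - c\<bar> \<le> (mertens_B + 1) / ln (real x)"
  shows "c = euler_mascheroni"
proof -
  define a where "a = (\<lambda>k. prime_log_sum (exp_floor k) - prime_log_sum (exp_floor (k - 1)))"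
  define b where "b = (\<lambda>k. a k - 1 / real k)"
  define \<beta> where "\<beta> = c - euler_mascheroni"
  define L where "L = ln_sq_const"
  have exp_floor_top: "filterlim exp_floor at_top sequentially"
    unfolding exp_floor_def by real_asymp
  have "(\<lambda>x. prime_log_sum x - ln (ln (real x)) - c) \<longlonglongrightarrow> 0"
  proof (rule Lim_null_comparison)
    show "\<forall>\<^sub>F x in sequentially. norm (prime_log_sum x - ln (ln (real x)) - c) \<le> (mertens_B + 1) / ln (real x)"
      using eventually_ge_at_top[of 2] by eventually_elim (use c in auto)
    show "(\<lambda>x. (mertens_B + 1) / ln (real x)) \<longlonglongrightarrow> 0" by real_asymp
  qed
  from filterlim_compose[OF this exp_floor_top] have 1: "(\<lambda>K. prime_log_sum (exp_floor K) - ln (ln (real (exp_floor K))) - c) \<longlonglongrightarrow> 0" .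
  have 2: "(\<lambda>K. ln (ln (real (exp_floor K))) - ln (real K)) \<longlonglongrightarrow> 0"
    unfolding exp_floor_def by real_asymp
  have "(\<lambda>K. (prime_log_sum (exp_floor K) - ln (ln (real (exp_floor K))) - c) +
             (ln (ln (real (exp_floor K))) - ln (real K)) - (harm K - ln (real K)) + c)
         \<longlonglongrightarrow> 0 + 0 - euler_mascheroni + c"
    by (intro tendsto_intros 1 2 euler_mascheroni_LIMSEQ)
  hence "(\<lambda>K. prime_log_sum (exp_floor K) - harm K) \<longlonglongrightarrow> \<beta>"
    by (simp add: \<beta>_def)
  moreover have "(\<Sum>k=1..K. b k) = prime_log_sum (exp_floor K) - harm K" for K
  proof -
    have "(\<Sum>k=1..K. a k) = prime_log_sum (exp_floor K) - prime_log_sum (exp_floor 0)"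
      unfolding a_def using sum_telescope_Suc[of 0 K "\<lambda>k. prime_log_sum (exp_floor k)"] by simp
    thus ?thesis by (simp add: b_def sum_subtractf harm_def prime_log_sum_def divide_inverse)
  qed
  ultimately have blim: "(\<lambda>K. \<Sum>k=1..K. b k) \<longlonglongrightarrow> \<beta>" by simp

  have bounds: "\<beta> \<le> e \<and> -e \<le> \<beta>" if e: "e > 0" for e
  proof -
    obtain M C where MC: "\<And>r n. 0 < r \<Longrightarrow> r < 1 \<Longrightarrow> n \<ge> M \<Longrightarrow>
        \<bar>(\<Sum>k=1..n. b k * r ^ k) - \<beta>\<bar> \<le> e + (1 - r) * C"
      using abel_limit_finite[OF blim e] by blast
    \<comment> \<open>For fixed d the limit K to infinity turns \<open>Z\<close> into
      \<open>ln \<zeta>\<close> and \<open>H\<close> into - ln (1 - r). Only afterwards does d tend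
      to 0, which the uniformity of \<open>MC\<close> permits.\<close>
    have main: "\<beta> \<le> e + (1 - exp (-d)) * C + ln (1 + 1 / d) + 2 * d * L + ln (1 - exp (-d))"
               "exp (-d) * (ln (1 / d) - 2 * d * L) + ln (1 - exp (-d)) - e - (1 - exp (-d)) * C \<le> \<beta>"
      if d: "d > 0" for d
    proof -
      define r where "r = exp (-d)"
      have r: "0 < r" "r < 1" using d by (auto simp: r_def)
      define G where "G = (\<lambda>K. \<Sum>n=2..exp_floor K. prime_log n * real n powr (-d))"
      define Z where "Z = (\<lambda>n. \<Sum>k=2..n. if prime k then - ln (1 - real k powr (-(1 + d))) else 0)"
      define \<zeta> where "\<zeta> = (\<Sum>n. real n powr (-(1 + d)))"
      define H where "H = (\<lambda>K. \<Sum>k=1..K. r ^ k / real k)"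
      have GZ: "\<bar>G K - Z (exp_floor K)\<bar> \<le> 2 * d * L" for K
      proof -
        have "\<bar>G K - Z (exp_floor K)\<bar> \<le> (\<Sum>n=2..exp_floor K. 2 * d * (ln (real n) / (real n)\<^sup>2))"
          unfolding G_def Z_def sum_subtractf[symmetric]
        proof (rule order_trans[OF sum_abs], rule sum_mono)
          fix n assume "n \<in> {2..exp_floor K}"
          thus "\<bar>prime_log n * real n powr - d - (if prime n then - ln (1 - real n powr - (1 + d)) else 0)\<bar>
                  \<le> 2 * d * (ln (real n) / (real n)\<^sup>2)"
          proof (cases "prime n")
            case True
            thus ?thesis using prime_log_twist[OF True d] by simp
          qed (use d in \<open>auto simp: prime_log_def\<close>)
        qed
        also have "\<dots> \<le> 2 * d * L" unfolding sum_distrib_left[symmetric] L_def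
          using d by (intro mult_left_mono sum_ln_over_square_le) auto
        finally show ?thesis .
      qed
      have Zlim: "(\<lambda>K. Z (exp_floor K)) \<longlonglongrightarrow> ln \<zeta>"
      proof (rule filterlim_compose[OF _ exp_floor_top])
        show "Z \<longlonglongrightarrow> ln \<zeta>" unfolding Z_def \<zeta>_def using d by (intro euler_product_log) auto
      qed
      have "(\<lambda>n. - (r ^ n) / real n) sums ln (1 - r)"
        using ln_series'[of "-r"] r by simp
      hence "(\<lambda>n. r ^ n / real n) sums (- ln (1 - r))"
        using sums_minus by fastforce
      hence "(\<lambda>n. \<Sum>k\<le>n. r ^ k / real k) \<longlonglongrightarrow> - ln (1 - r)"
        by (simp add: sums_def_le)
      \<comment> \<open>The term k = 0 is a division by zero and hence 0.\<close>
      moreover have "(\<Sum>k\<le>n. r ^ k / real k) = H n" for n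
        unfolding H_def by (intro sum.mono_neutral_right) auto
      ultimately have Hlim: "H \<longlonglongrightarrow> - ln (1 - r)" by simp
      have T: "(\<Sum>k=1..K. b k * r ^ k) = (\<Sum>k=1..K. a k * r ^ k) - H K" for K
        unfolding b_def H_def sum_subtractf[symmetric] by (intro sum.cong) (auto simp: algebra_simps)
      have blk: "(\<Sum>k=1..K. a k * r ^ k) \<le> G K" "r * G K \<le> (\<Sum>k=1..K. a k * r ^ k)" for K
        unfolding r_def a_def G_def by (rule prime_log_block_bounds[OF d])+
      have zb: "ln (1 / d) \<le> ln \<zeta>" "ln \<zeta> \<le> ln (1 + 1 / d)"
      proof -
        have p: "0 < 1 / d" using d by simp
        have z: "1 / d \<le> \<zeta>" "\<zeta> \<le> 1 + 1 / d"
          using zeta_real_bounds[OF d] unfolding \<zeta>_def[symmetric] by auto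
        have p': "0 < \<zeta>" "0 < 1 + 1 / d" using z p by linarith+
        show "ln (1 / d) \<le> ln \<zeta>" using ln_le_cancel_iff[OF p p'(1)] z by blast
        show "ln \<zeta> \<le> ln (1 + 1 / d)" using ln_le_cancel_iff[OF p'] z by blast
      qed
      have "\<beta> - e - (1 - r) * C \<le> ln \<zeta> + 2 * d * L - (- ln (1 - r))"
      proof (rule tendsto_lowerbound)
        show "(\<lambda>K. Z (exp_floor K) + 2 * d * L - H K) \<longlonglongrightarrow> ln \<zeta> + 2 * d * L - (- ln (1 - r))"
          by (intro tendsto_intros Zlim Hlim)
        show "\<forall>\<^sub>F K in sequentially. \<beta> - e - (1 - r) * C \<le> Z (exp_floor K) + 2 * d * L - H K"
          using eventually_ge_at_top[of M]
        proof eventually_elim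
          case (elim K)
          show ?case using MC[OF r elim] blk(1)[of K] GZ[of K] unfolding T by linarith
        qed
      qed auto
      thus "\<beta> \<le> e + (1 - exp (-d)) * C + ln (1 + 1 / d) + 2 * d * L + ln (1 - exp (-d))"
        using zb unfolding r_def[symmetric] by linarith
      have "r * (ln \<zeta> - 2 * d * L) - (- ln (1 - r)) \<le> \<beta> + e + (1 - r) * C"
      proof (rule tendsto_upperbound)
        show "(\<lambda>K. r * (Z (exp_floor K) - 2 * d * L) - H K) \<longlonglongrightarrow> r * (ln \<zeta> - 2 * d * L) - (- ln (1 - r))"
          by (intro tendsto_intros Zlim Hlim)
        show "\<forall>\<^sub>F K in sequentially. r * (Z (exp_floor K) - 2 * d * L) - H K \<le> \<beta> + e + (1 - r) * C"
          using eventually_ge_at_top[of M]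
        proof eventually_elim
          case (elim K)
          have "r * (Z (exp_floor K) - 2 * d * L) \<le> r * G K"
            using GZ[of K] r by (intro mult_left_mono) auto
          thus ?case using MC[OF r elim] blk(2)[of K] unfolding T by linarith
        qed
      qed auto
      moreover have "r * (ln (1 / d) - 2 * d * L) \<le> r * (ln \<zeta> - 2 * d * L)"
        using zb r by (intro mult_left_mono) auto
      ultimately show "exp (-d) * (ln (1 / d) - 2 * d * L) + ln (1 - exp (-d)) - e - (1 - exp (-d)) * C \<le> \<beta>"
        unfolding r_def[symmetric] by linarith
    qed
    \<comment> \<open>The singular parts ln (1 + 1/d) and ln (1 - exp (-d)) cancel as d tends to 0,
      and every other term but e vanishes.\<close>
    have "\<beta> \<le> e"
    proof (rule tendsto_lowerbound)
      show "((\<lambda>d. e + (1 - exp (-d)) * C + ln (1 + 1 / d) + 2 * d * L + ln (1 - exp (-d))) \<longlongrightarrow> e) (at_right 0)"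
        by real_asymp
      show "\<forall>\<^sub>F d in at_right 0. \<beta> \<le> e + (1 - exp (-d)) * C + ln (1 + 1 / d) + 2 * d * L + ln (1 - exp (-d))"
        using eventually_at_right_less[of 0] by eventually_elim (rule main(1))
    qed auto
    moreover have "-e \<le> \<beta>"
    proof (rule tendsto_upperbound)
      show "((\<lambda>d. exp (-d) * (ln (1 / d) - 2 * d * L) + ln (1 - exp (-d)) - e - (1 - exp (-d)) * C) \<longlongrightarrow> -e) (at_right 0)"
        by real_asymp
      show "\<forall>\<^sub>F d in at_right 0. exp (-d) * (ln (1 / d) - 2 * d * L) + ln (1 - exp (-d)) - e - (1 - exp (-d)) * C \<le> \<beta>"
        using eventually_at_right_less[of 0] by eventually_elim (rule main(2))
    qed auto
    ultimately show ?thesis by blast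
  qed
  have "\<beta> = 0"
  proof (rule ccontr)
    assume "\<beta> \<noteq> 0"
    hence p: "\<bar>\<beta>\<bar> / 2 > 0" by simp
    show False using bounds[OF p] p by linarith
  qed
  thus ?thesis by (simp add: \<beta>_def)
qed

lemma mertens_third_log:
  assumes "2 \<le> x"
  shows "\<bar>prime_log_sum x - ln (ln (real x)) - euler_mascheroni\<bar> \<le> (mertens_B + 1) / ln (real x)"
  using mertens_second mertens_constant assms by metis

subsection \<open>Sieving by small primes\<close>

definition prime_log_below :: "nat \<Rightarrow> real" where
  "prime_log_below j = (\<Sum>k<j. prime_log k)"

lemma prime_log_below_Suc: "prime_log_below (Suc j) = prime_log_below j + prime_log j"
  by (simp add: prime_log_below_def)

text \<open>Dropping the endpoint loses at most \<open>prime_log j\<close> \<le> 2/j \<le> 2 / ln j,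
  hence \<open>mertens_B + 3\<close> in place of \<open>mertens_B + 1\<close>.\<close>

lemma prime_log_below_bound:
  assumes "j \<ge> 2"
  shows "\<bar>prime_log_below j - ln (ln (real j)) - euler_mascheroni\<bar> \<le> (mertens_B + 3) / ln (real j)"
proof -
  have "prime_log_sum j = (\<Sum>k<Suc j. prime_log k)"
    unfolding prime_log_sum_def
  proof (intro sum.mono_neutral_left ballI)
    fix k assume "k \<in> {..<Suc j} - {2..j}"
    hence "k = 0 \<or> k = 1" by auto
    thus "prime_log k = 0" by (auto simp: prime_log_def)
  qed auto
  hence eq: "prime_log_sum j = prime_log_below j + prime_log j" by (simp add: prime_log_below_def)
  have "prime_log j \<le> 2 / real j" using prime_log_bounds(3)[of j] assms
    by (cases "prime j") (auto simp: prime_log_def)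
  also have "\<dots> \<le> 2 / ln (real j)" using assms ln_le_minus_one[of "real j"]
    by (intro divide_left_mono) auto
  finally have "prime_log j \<le> 2 / ln (real j)" .
  moreover have "(mertens_B + 3) / ln (real j) = (mertens_B + 1) / ln (real j) + 2 / ln (real j)"
    by (simp add: add_divide_distrib[symmetric])
  ultimately show ?thesis
    using mertens_third_log[OF assms] prime_log_nonneg[of j] unfolding eq by linarith
qed

text \<open>The product of 1 - 1/p over the primes p < j, given through its logarithm so that the
  bounds for \<open>prime_log_below\<close> apply directly.\<close>

definition sieve_density :: "nat \<Rightarrow> real" where
  "sieve_density j = exp (- prime_log_below j)"

lemma sieve_density_Suc:
  "sieve_density (Suc j) = (if prime j then 1 - 1 / real j else 1) * sieve_density j"
proof (cases "prime j")
  case True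
  hence "1 / real j < 1" using prime_gt_1_nat[OF True] by simp
  hence "exp (ln (1 - 1 / real j)) = 1 - 1 / real j" by simp
  thus ?thesis using True
    by (simp add: sieve_density_def prime_log_below_Suc prime_log_def exp_diff exp_minus divide_inverse)
qed (simp add: sieve_density_def prime_log_below_Suc prime_log_def)

lemma abs_exp_minus_one_le: "\<bar>exp x - 1\<bar> \<le> \<bar>x\<bar> * exp \<bar>x\<bar>" for x :: real
proof (cases "x \<ge> 0")
  case True
  have "1 - x \<le> exp (-x)" using exp_ge_add_one_self[of "-x"] by simp
  hence "(1 - x) * exp x \<le> exp (-x) * exp x" by (intro mult_right_mono) auto
  thus ?thesis using True by (simp add: exp_minus algebra_simps)
next
  case False
  have "1 - exp x \<le> -x * 1" using exp_ge_add_one_self[of x] by linarith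
  also have "\<dots> \<le> -x * exp (-x)" using False by (intro mult_left_mono) auto
  finally show ?thesis using False by simp
qed

text \<open>The logarithm is known up to O(1 / ln j). Exponentiating makes this a relative error, so
  the absolute error gains a second factor 1 / ln j.\<close>

lemma mertens_third:
  obtains C where "C \<ge> 0" "\<And>j. j \<ge> 2 \<Longrightarrow>
    \<bar>sieve_density j - exp (- euler_mascheroni) / ln (real j)\<bar> \<le> C / (ln (real j))\<^sup>2"
proof -
  define K where "K = mertens_B + 3"
  define C where "C = K * exp (K / ln 2)"
  have K: "K > 0" using mertens_B_pos by (simp add: K_def)
  show ?thesis
  proof (rule that[of C])
    show "C \<ge> 0" using K by (simp add: C_def)
    fix j :: nat assume j: "j \<ge> 2"
    define \<eta> where "\<eta> = - (prime_log_below j - ln (ln (real j)) - euler_mascheroni)"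
    have lnj: "ln (real j) > 0" "ln (real j) \<ge> ln 2" using j by auto
    have eta: "\<bar>\<eta>\<bar> \<le> K / ln (real j)" using prime_log_below_bound[OF j] by (simp add: \<eta>_def K_def)
    also have "\<dots> \<le> K / ln 2" using lnj K by (intro divide_left_mono) auto
    finally have eta': "\<bar>\<eta>\<bar> \<le> K / ln 2" .
    have "sieve_density j = exp (\<eta> - ln (ln (real j)) - euler_mascheroni)"
      by (simp add: sieve_density_def \<eta>_def)
    also have "\<dots> = exp \<eta> * (exp (- euler_mascheroni) / ln (real j))"
      using lnj by (simp add: exp_diff exp_minus exp_add field_simps)
    finally have "sieve_density j - exp (- euler_mascheroni) / ln (real j) =
        (exp \<eta> - 1) * (exp (- euler_mascheroni) / ln (real j))" by (simp only: left_diff_distrib mult_1)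
    hence "\<bar>sieve_density j - exp (- euler_mascheroni) / ln (real j)\<bar> =
        \<bar>exp \<eta> - 1\<bar> * (exp (- euler_mascheroni) / ln (real j))" using lnj by (simp add: abs_mult)
    also have "\<dots> \<le> (K / ln (real j) * exp (K / ln 2)) * (1 / ln (real j))"
    proof (intro mult_mono divide_right_mono)
      show "\<bar>exp \<eta> - 1\<bar> \<le> K / ln (real j) * exp (K / ln 2)"
        using eta eta' K lnj by (intro order_trans[OF abs_exp_minus_one_le] mult_mono) auto
      show "exp (- euler_mascheroni) \<le> (1::real)" using euler_mascheroni_pos by simp
    qed (use K lnj in auto)
    also have "\<dots> = C / (ln (real j))\<^sup>2" by (simp add: C_def power2_eq_square)
    finally show "\<bar>sieve_density j - exp (- euler_mascheroni) / ln (real j)\<bar> \<le> C / (ln (real j))\<^sup>2" .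
  qed
qed

text \<open>The argument x is real because the sieve recursion passes from x to x / p without
  rounding.\<close>

definition rough_count :: "real \<Rightarrow> nat \<Rightarrow> nat" where
  "rough_count x j = card {m. rough j m \<and> real m \<le> x}"

lemma finite_rough_le: "finite {m. rough j m \<and> real m \<le> x}"
proof (rule finite_subset)
  show "{m. rough j m \<and> real m \<le> x} \<subseteq> {..nat \<lfloor>x\<rfloor>}"
    by (auto simp: le_nat_floor)
qed simp

lemma rough_count_Suc_prime:
  assumes "prime p"
  shows "real (rough_count x (Suc p)) = real (rough_count x p) - real (rough_count (x / real p) p)"
proof -
  have p: "p > 0" using assms prime_gt_0_nat by blast
  have eq: "{m. rough p m \<and> real m \<le> x} = {m. rough (Suc p) m \<and> real m \<le> x} \<union>
          (*) p ` {m. rough p m \<and> real m \<le> x / real p}"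
  proof -
    have iff: "rough p m \<longleftrightarrow> rough (Suc p) m \<or> (\<exists>k. rough p k \<and> m = p * k)" for m
      using rough_set_split(1)[OF assms] by blast
    have le: "real (p * k) \<le> x \<longleftrightarrow> real k \<le> x / real p" for k
      using p by (simp add: pos_le_divide_eq mult.commute)
    show ?thesis
    proof (intro equalityI subsetI)
      fix m assume "m \<in> {m. rough p m \<and> real m \<le> x}"
      thus "m \<in> {m. rough (Suc p) m \<and> real m \<le> x} \<union> (*) p ` {m. rough p m \<and> real m \<le> x / real p}"
        using iff[of m] le by blast
    next
      fix m assume "m \<in> {m. rough (Suc p) m \<and> real m \<le> x} \<union> (*) p ` {m. rough p m \<and> real m \<le> x / real p}"
      thus "m \<in> {m. rough p m \<and> real m \<le> x}" using iff[of m] le by blast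
    qed
  qed
  have "rough_count x p = rough_count x (Suc p) + card ((*) p ` {m. rough p m \<and> real m \<le> x / real p})"
    unfolding rough_count_def eq using rough_set_split(2)[OF assms]
    by (intro card_Un_disjoint finite_rough_le finite_imageI) auto
  also have "card ((*) p ` {m. rough p m \<and> real m \<le> x / real p}) = rough_count (x / real p) p"
    unfolding rough_count_def using p by (intro card_image) (auto simp: inj_on_def)
  finally show ?thesis by simp
qed

lemma rough_count_Suc_nonprime: "\<not>prime j \<Longrightarrow> rough_count x (Suc j) = rough_count x j"
  by (simp add: rough_count_def rough_Suc_iff)

text \<open>Legendre's sieve with Rankin's trick: bounding the rounding error of a single floor by
  \<open>x powr (1 - e)\<close> instead of \<open>1\<close> makes the \<open>2 ^ \<pi>(j)\<close> error terms sum to an Euler product.\<close>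

lemma legendre_rankin_aux:
  fixes x e :: real
  assumes "x > 0" "0 \<le> e" "e \<le> 1" "\<And>p. p < j \<Longrightarrow> prime p \<Longrightarrow> real p powr e \<le> 3"
  shows "\<bar>real (rough_count x j) - x * sieve_density j\<bar> \<le> x powr (1 - e) * exp (3 * prime_log_below j)"
  using assms(1,4)
proof (induction j arbitrary: x)
  case 0
  have "{m. rough 0 m \<and> real m \<le> x} = {1..nat \<lfloor>x\<rfloor>}"
    using 0 by (auto simp: rough_le_2 le_nat_iff le_floor_iff Suc_le_eq)
  hence eq: "real (rough_count x 0) = of_int \<lfloor>x\<rfloor>" using 0 by (simp add: rough_count_def)
  \<comment> \<open>For x < 1 the floor is 0 and the error is x itself, still at most
    \<open>x powr (1 - e)\<close>. This range matters because the recursion divides x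
    repeatedly.\<close>
  have "\<bar>real_of_int \<lfloor>x\<rfloor> - x\<bar> \<le> x powr (1 - e)"
  proof (cases "x \<ge> 1")
    case True
    have "\<bar>real_of_int \<lfloor>x\<rfloor> - x\<bar> \<le> 1" by linarith
    also have "1 \<le> x powr (1 - e)" using True assms by (intro ge_one_powr_ge_zero) auto
    finally show ?thesis .
  next
    case False
    hence "\<lfloor>x\<rfloor> = 0" using 0 by (simp add: floor_eq_iff)
    moreover have "x powr 1 \<le> x powr (1 - e)" using False 0 assms by (intro powr_mono') auto
    ultimately show ?thesis using 0 by simp
  qed
  thus ?case by (simp add: eq sieve_density_def prime_log_below_def)
next
  case (Suc j)
  have IH: "\<bar>real (rough_count y j) - y * sieve_density j\<bar> \<le> y powr (1 - e) * exp (3 * prime_log_below j)"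
    if "y > 0" for y using Suc.IH[OF that] Suc.prems(2) by simp
  show ?case
  proof (cases "prime j")
    case True
    have j: "real j > 0" using prime_gt_0_nat[OF True] by simp
    \<comment> \<open>Passing to x / p multiplies the error by p^e / p, at most 3
      \<open>prime_log p\<close>; then 1 + t \<le> exp t keeps the accumulated error in product
      form.\<close>
    have "(x / real j) powr (1 - e) = x powr (1 - e) * (real j powr e * (1 / real j))"
      using j Suc.prems by (simp add: powr_divide powr_diff field_simps)
    also have "\<dots> \<le> x powr (1 - e) * (3 * prime_log j)"
      using Suc.prems(2)[of j] True prime_log_bounds(1)[OF True] j by (intro mult_left_mono mult_mono) auto
    finally have xj: "(x / real j) powr (1 - e) \<le> x powr (1 - e) * (3 * prime_log j)" .
    have "real (rough_count x (Suc j)) - x * sieve_density (Suc j) =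
       (real (rough_count x j) - x * sieve_density j) -
       (real (rough_count (x / real j) j) - x / real j * sieve_density j)"
      using True j by (simp add: rough_count_Suc_prime sieve_density_Suc algebra_simps)
    also have "\<bar>\<dots>\<bar> \<le> x powr (1 - e) * exp (3 * prime_log_below j) +
                (x / real j) powr (1 - e) * exp (3 * prime_log_below j)"
      using IH[OF Suc.prems(1)] IH[of "x / real j"] divide_pos_pos[OF Suc.prems(1) j] by linarith
    also have "\<dots> \<le> x powr (1 - e) * exp (3 * prime_log_below j) +
                 x powr (1 - e) * (3 * prime_log j) * exp (3 * prime_log_below j)"
      using xj by (intro add_left_mono mult_right_mono) auto
    also have "\<dots> = x powr (1 - e) * exp (3 * prime_log_below j) * (1 + 3 * prime_log j)"
      by (simp add: algebra_simps)
    also have "\<dots> \<le> x powr (1 - e) * exp (3 * prime_log_below j) * exp (3 * prime_log j)"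
      by (intro mult_left_mono exp_ge_add_one_self) auto
    also have "\<dots> = x powr (1 - e) * exp (3 * prime_log_below (Suc j))"
      by (simp add: prime_log_below_Suc exp_add distrib_left)
    finally show ?thesis .
  next
    case False
    thus ?thesis using IH[OF Suc.prems(1)]
      by (simp add: rough_count_Suc_nonprime sieve_density_Suc prime_log_below_Suc prime_log_def)
  qed
qed

text \<open>The choice e = 1 / ln j gives p^e \<le> exp 1 \<le> 3 for all p < j and turns x^(-e)
  into exp (- ln x / ln j). The factor (ln j)^3 is the cube of the inverse Mertens product, up to a
  constant; j \<ge> 3 ensures e \<le> 1.\<close>

lemma legendre_rankin:
  obtains C where "C \<ge> 0" "\<And>x j. x > 0 \<Longrightarrow> j \<ge> 3 \<Longrightarrow>
    \<bar>real (rough_count x j) - x * sieve_density j\<bar> \<le> C * x * ln (real j) ^ 3 * exp (- ln x / ln (real j))"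
proof -
  define K where "K = mertens_B + 3 + euler_mascheroni"
  have K: "K \<ge> 0" using mertens_B_pos euler_mascheroni_pos unfolding K_def by linarith
  show ?thesis
  proof (rule that[of "exp (3 * K)"])
    fix x :: real and j :: nat assume x: "x > 0" and j: "j \<ge> 3"
    have "exp 1 \<le> real j"
    proof -
      have "real j \<ge> 3" using j by simp
      thus ?thesis using exp_le by linarith
    qed
    hence lnj: "ln (real j) \<ge> 1" using j by (subst ln_ge_iff) auto
    define e where "e = 1 / ln (real j)"
    have e: "0 \<le> e" "e \<le> 1" using lnj by (auto simp: e_def)
    have "\<bar>real (rough_count x j) - x * sieve_density j\<bar> \<le> x powr (1 - e) * exp (3 * prime_log_below j)"
    proof (rule legendre_rankin_aux[OF x e])
      fix p assume p: "p < j" "prime p"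
      have "real p powr e \<le> real j powr e" using p e by (intro powr_mono2) auto
      also have "\<dots> = exp 1" using lnj j by (simp add: e_def powr_def)
      also have "\<dots> \<le> 3" by (rule exp_le)
      finally show "real p powr e \<le> 3" .
    qed
    also have "x powr (1 - e) = x * exp (- ln x / ln (real j))"
      using x by (simp add: e_def powr_def left_diff_distrib exp_diff exp_minus divide_inverse)
    also have "exp (3 * prime_log_below j) \<le> exp (3 * (ln (ln (real j)) + K))"
    proof -
      have "(mertens_B + 3) / ln (real j) \<le> mertens_B + 3"
        using lnj mertens_B_pos divide_left_mono[of 1 "ln (real j)" "mertens_B + 3"] by simp
      hence "prime_log_below j \<le> ln (ln (real j)) + K"
        using prime_log_below_bound[of j] j unfolding K_def by linarith
      thus ?thesis by simp
    qed
    also have "exp (3 * (ln (ln (real j)) + K)) = ln (real j) ^ 3 * exp (3 * K)"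
    proof -
      have "exp (3 * ln (ln (real j))) = ln (real j) ^ 3"
        using lnj exp_of_nat_mult[of 3 "ln (ln (real j))"] by simp
      thus ?thesis by (simp add: distrib_left exp_add)
    qed
    finally show "\<bar>real (rough_count x j) - x * sieve_density j\<bar> \<le>
        exp (3 * K) * x * ln (real j) ^ 3 * exp (- ln x / ln (real j))"
      using x by (simp add: mult_ac)
  qed simp
qed

subsection \<open>An upper bound for rough numbers and the least prime factor\<close>

lemma harm_le_ln: "n \<ge> 1 \<Longrightarrow> harm n \<le> ln (real n) + 1"
  using euler_mascheroni_sequence_decreasing[of 1 n] by (simp add: harm_expand)

lemma rough_count_nat: "rough_count (real x) j = card {m\<in>{1..x}. rough j m}"
  unfolding rough_count_def by (rule arg_cong[of _ _ card]) (auto simp: Suc_le_eq rough_pos)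

lemma rough_times_small_inj:
  assumes "rough j m" "rough j m'" "k \<in> {1..<j}" "k' \<in> {1..<j}" "m * k = m' * k'"
  shows "m = m' \<and> k = k'"
proof -
  have cop: "coprime a b" if "rough j a" "b \<in> {1..<j}" for a b
  proof (rule ccontr)
    assume "\<not>coprime a b"
    then obtain p where p: "prime p" "p dvd a" "p dvd b"
      using prime_factor_nat[of "gcd a b"] by (auto simp: coprime_iff_gcd_eq_1)
    have "p \<le> b" using p that by (intro dvd_imp_le) auto
    thus False using p that by (auto simp: rough_def)
  qed
  have "m dvd m' * k'" using assms(5) by (metis dvd_triv_left)
  hence 1: "m dvd m'" using cop[OF assms(1,4)] by (simp add: coprime_dvd_mult_left_iff)
  have "m' dvd m * k" using assms(5) by (metis dvd_triv_left)
  hence 2: "m' dvd m" using cop[OF assms(2,3)] by (simp add: coprime_dvd_mult_left_iff)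
  have "m = m'" using 1 2 by (rule dvd_antisym)
  thus ?thesis using assms(5) rough_pos[OF assms(1)] by simp
qed

lemma sum_rough_inverse_le:
  assumes "2 \<le> j" "j \<le> x"
  shows "(\<Sum>m\<in>{m\<in>{1..x}. rough j m}. 1 / real m) \<le> 4 * ln (real x) / ln (real j)"
proof -
  define A where "A = {m\<in>{1..x}. rough j m}"
  have lnx: "ln (real x) \<ge> 1/2"
  proof -
    have "ln 2 \<le> ln (real x)" using assms by simp
    thus ?thesis using ln2_ge_two_thirds by linarith
  qed
  have lnj: "ln (real j) > 0" using assms by simp
  have "(\<Sum>m\<in>A. 1 / real m) * harm (j - 1) = (\<Sum>(m,k)\<in>A \<times> {1..<j}. 1 / real (m * k))"
  proof -
    have "{1..j - 1} = {1..<j}" using assms by auto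
    thus ?thesis
      by (simp add: harm_def sum_product sum.cartesian_product divide_inverse)
  qed
  also have "\<dots> = (\<Sum>n\<in>(\<lambda>(m,k). m * k) ` (A \<times> {1..<j}). 1 / real n)"
  proof (subst sum.reindex)
    show "inj_on (\<lambda>(m,k). m * k) (A \<times> {1..<j})"
      using rough_times_small_inj[of j] by (fastforce simp: inj_on_def A_def)
  qed (auto simp: case_prod_unfold)
  also have "\<dots> \<le> (\<Sum>n\<in>{1..x * x}. 1 / real n)"
  proof (intro sum_mono2)
    show "(\<lambda>(m,k). m * k) ` (A \<times> {1..<j}) \<subseteq> {1..x * x}"
      using assms by (auto simp: A_def intro!: mult_le_mono)
  qed auto
  also have "\<dots> = harm (x * x)" by (simp add: harm_def divide_inverse)
  also have "\<dots> \<le> ln (real (x * x)) + 1" using assms by (intro harm_le_ln) auto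
  also have "\<dots> = 2 * ln (real x) + 1" using assms by (simp add: ln_mult)
  also have "\<dots> \<le> 4 * ln (real x)" using lnx by simp
  finally have "(\<Sum>m\<in>A. 1 / real m) * harm (j - 1) \<le> 4 * ln (real x)" .
  moreover have "(\<Sum>m\<in>A. 1 / real m) * ln (real j) \<le> (\<Sum>m\<in>A. 1 / real m) * harm (j - 1)"
    using ln_le_harm[of "j - 1"] assms by (intro mult_left_mono sum_nonneg) auto
  ultimately show ?thesis using lnj by (simp add: A_def pos_le_divide_eq)
qed

text \<open>Write ln n as the sum of \<open>mangoldt d\<close> over d dividing n. The cofactor m = n
  / d is again rough, and for fixed m the values of d are at most x / m, so Chebyshev's bound gives
  3 x / m.\<close>

lemma sum_ln_rough_le:
  "(\<Sum>n\<in>{m\<in>{1..x}. rough j m}. ln (real n)) \<le> 3 * real x * (\<Sum>m\<in>{m\<in>{1..x}. rough j m}. 1 / real m)"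
proof -
  define A where "A = {m\<in>{1..x}. rough j m}"
  have finA: "finite A" by (simp add: A_def)
  have pos: "n > 0" if "n \<in> A" for n using that by (auto simp: A_def)
  have "(\<Sum>n\<in>A. ln (real n)) = (\<Sum>n\<in>A. \<Sum>d | d dvd n. mangoldt d)"
    using mangoldt_sum[where 'a = real] pos by (intro sum.cong) auto
  also have "\<dots> = (\<Sum>(n,d)\<in>Sigma A (\<lambda>n. {d. d dvd n}). mangoldt d)"
    using pos by (intro sum.Sigma finA) auto
  also have "\<dots> = (\<Sum>(m,d)\<in>(\<lambda>(n,d). (n div d, d)) ` Sigma A (\<lambda>n. {d. d dvd n}). mangoldt d)"
    by (subst sum.reindex) (auto simp: inj_on_def case_prod_unfold dest: pos elim!: dvdE)
  also have "\<dots> \<le> (\<Sum>(m,d)\<in>Sigma A (\<lambda>m. {1..x div m}). mangoldt d)"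
  proof (intro sum_mono2)
    show "(\<lambda>(n,d). (n div d, d)) ` Sigma A (\<lambda>n. {d. d dvd n}) \<subseteq> Sigma A (\<lambda>m. {1..x div m})"
    proof clarify
      fix n d assume n: "n \<in> A" and d: "d dvd n"
      then obtain k where k: "n = d * k" by blast
      have dk: "d > 0" "k > 0" using pos[OF n] k by auto
      have "1 * k \<le> d * k" using dk by (intro mult_le_mono) auto
      moreover have "d * k \<le> x" using n k by (simp add: A_def)
      ultimately have "k \<le> x" by linarith
      hence "k \<in> A" using n k dk by (auto simp: A_def rough_mult_iff)
      moreover have "d \<le> x div k" using n k dk by (simp add: less_eq_div_iff_mult_less_eq A_def)
      ultimately show "n div d \<in> A \<and> d \<in> {1..x div (n div d)}" using k dk by simp
    qed
  qed (auto simp: finA mangoldt_nonneg)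
  also have "\<dots> = (\<Sum>m\<in>A. cheb_psi (x div m))"
    unfolding cheb_psi_def by (subst sum.Sigma) (auto simp: finA)
  also have "\<dots> \<le> (\<Sum>m\<in>A. 3 * real x * (1 / real m))"
  proof (intro sum_mono)
    fix m
    have "cheb_psi (x div m) \<le> 3 * real (x div m)" by (rule cheb_psi_le)
    also have "real (x div m) \<le> real x / real m" by (rule of_nat_div_le_of_nat)
    finally show "cheb_psi (x div m) \<le> 3 * real x * (1 / real m)" by simp
  qed
  finally show ?thesis by (simp add: A_def sum_distrib_left)
qed

text \<open>Counting with weight ln x = ln n + ln (x / n) bounds the weighted count by (3 + 1) x
  times the harmonic sum over rough numbers, and that sum is at most 4 ln x / ln j. The bound is
  uniform in j, which Legendre's sieve is not; the + 1 accounts for j > x, where only n = 1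
  survives.\<close>

lemma rough_count_upper:
  assumes "2 \<le> j" "1 \<le> x"
  shows "real (rough_count (real x) j) \<le> 16 * real x / ln (real j) + 1"
proof (cases "j \<le> x")
  case True
  define A where "A = {m\<in>{1..x}. rough j m}"
  define S where "S = (\<Sum>m\<in>A. 1 / real m)"
  have lnx: "ln (real x) > 0" using True assms by simp
  have "real (card A) * ln (real x) = (\<Sum>n\<in>A. ln (real n) + ln (real x / real n))"
    using assms by (subst sum_constant[symmetric], intro sum.cong) (auto simp: A_def ln_div)
  also have "\<dots> \<le> (\<Sum>n\<in>A. ln (real n)) + real x * S"
    unfolding sum.distrib S_def sum_distrib_left
  proof (intro add_left_mono sum_mono)
    fix n assume n: "n \<in> A"
    have "ln (real x / real n) \<le> real x / real n - 1"
      using n assms by (intro ln_le_minus_one divide_pos_pos) (auto simp: A_def)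
    thus "ln (real x / real n) \<le> real x * (1 / real n)" by simp
  qed
  also have "\<dots> \<le> 4 * real x * S" using sum_ln_rough_le[where x = x and j = j] by (simp add: A_def S_def)
  also have "\<dots> \<le> 4 * real x * (4 * ln (real x) / ln (real j))"
    unfolding S_def A_def using assms True by (intro mult_left_mono sum_rough_inverse_le) auto
  also have "\<dots> = (16 * real x / ln (real j)) * ln (real x)" by simp
  finally have "real (card A) \<le> 16 * real x / ln (real j)" using lnx by (rule mult_right_le_imp_le)
  thus ?thesis by (simp add: rough_count_nat A_def)
next
  case False
  have "{m\<in>{1..x}. rough j m} \<subseteq> {1}" using False rough_ge[of j] by fastforce
  hence "card {m\<in>{1..x}. rough j m} \<le> card {1::nat}" by (intro card_mono) auto
  moreover have "16 * real x / ln (real j) \<ge> 0" using assms by simp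
  ultimately show ?thesis by (simp add: rough_count_nat)
qed

section \<open>The least prime factor and its mean over multiples\<close>

definition lpf :: "nat \<Rightarrow> nat" where
  "lpf n = (LEAST p. prime p \<and> p dvd n)"

lemma lpf:
  assumes "n \<ge> 2"
  shows "prime (lpf n)" "lpf n dvd n" "lpf n \<le> n" "2 \<le> lpf n"
proof -
  have "\<exists>p. prime p \<and> p dvd n" using prime_factor_nat[of n] assms by auto
  from LeastI_ex[OF this] show *: "prime (lpf n)" "lpf n dvd n" by (auto simp: lpf_def)
  show "lpf n \<le> n" using * assms by (intro dvd_imp_le) auto
  show "2 \<le> lpf n" using * prime_ge_2_nat by blast
qed

lemma lpf_le: "prime p \<Longrightarrow> p dvd n \<Longrightarrow> lpf n \<le> p"
  unfolding lpf_def by (rule Least_le) simp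

lemma le_lpf_iff: "n \<ge> 2 \<Longrightarrow> j \<le> lpf n \<longleftrightarrow> rough j n"
  using lpf[of n] lpf_le[of _ n] by (auto simp: rough_def intro: order_trans)

text \<open>At most sqrt P of the j satisfy j^2 \<le> P, each contributing at most 2, while beyond
  that 1 / ln j \<le> 2 / ln P. With sqrt P \<le> 2 P / ln P this adds up to 6.\<close>

lemma sum_inverse_ln_le:
  assumes "P \<ge> 2"
  shows "(\<Sum>j=2..P. 1 / ln (real j)) \<le> 6 * real P / ln (real P)"
proof -
  have lnP: "ln (real P) > 0" using assms by simp
  have "(\<Sum>j=2..P. 1 / ln (real j)) \<le> (\<Sum>j=2..P. (if j\<^sup>2 \<le> P then 2 else 0) + 2 / ln (real P))"
  proof (intro sum_mono)
    fix j assume j: "j \<in> {2..P}"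
    show "1 / ln (real j) \<le> (if j\<^sup>2 \<le> P then 2 else 0) + 2 / ln (real P)"
    proof (cases "j\<^sup>2 \<le> P")
      case True
      have "ln 2 \<le> ln (real j)" using j by simp
      hence "ln (real j) \<ge> 1/2" using ln2_ge_two_thirds by linarith
      hence "1 / ln (real j) \<le> 2" by (simp add: field_simps)
      thus ?thesis using True lnP by (simp add: add_increasing2)
    next
      case False
      hence "real P \<le> real j ^ 2" by (metis linear of_nat_le_iff of_nat_power)
      hence "ln (real P) \<le> ln (real j ^ 2)" using assms by (intro ln_mono) auto
      hence "ln (real P) \<le> 2 * ln (real j)" using j by (simp add: ln_realpow)
      thus ?thesis using False lnP j by (simp add: field_simps)
    qed
  qed
  also have "\<dots> = 2 * real (card {j\<in>{2..P}. j\<^sup>2 \<le> P}) + real (P - 1) * (2 / ln (real P))"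
    by (simp add: sum.distrib sum.inter_filter[symmetric])
  also have "real (card {j\<in>{2..P}. j\<^sup>2 \<le> P}) \<le> sqrt (real P)"
  proof -
    have "{j\<in>{2..P}. j\<^sup>2 \<le> P} \<subseteq> {1..nat \<lfloor>sqrt (real P)\<rfloor>}"
    proof
      fix j assume j: "j \<in> {j\<in>{2..P}. j\<^sup>2 \<le> P}"
      hence "real j ^ 2 \<le> real P" by (metis (no_types, lifting) mem_Collect_eq of_nat_le_iff of_nat_power)
      hence "real j \<le> sqrt (real P)" by (rule real_le_rsqrt)
      thus "j \<in> {1..nat \<lfloor>sqrt (real P)\<rfloor>}" using j by (simp add: le_nat_floor)
    qed
    hence "card {j\<in>{2..P}. j\<^sup>2 \<le> P} \<le> card {1..nat \<lfloor>sqrt (real P)\<rfloor>}" by (intro card_mono) auto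
    hence "card {j\<in>{2..P}. j\<^sup>2 \<le> P} \<le> nat \<lfloor>sqrt (real P)\<rfloor>" by simp
    hence "real (card {j\<in>{2..P}. j\<^sup>2 \<le> P}) \<le> real (nat \<lfloor>sqrt (real P)\<rfloor>)" by (rule of_nat_mono)
    also have "\<dots> \<le> sqrt (real P)" by (rule of_nat_floor) simp
    finally show ?thesis .
  qed
  also have "sqrt (real P) \<le> 2 * real P / ln (real P)"
  proof -
    have "ln (real P) = 2 * ln (sqrt (real P))" using assms by (simp add: ln_sqrt)
    also have "ln (sqrt (real P)) \<le> sqrt (real P)"
      using ln_le_minus_one[of "sqrt (real P)"] assms by simp
    finally have "sqrt (real P) * ln (real P) \<le> sqrt (real P) * (2 * sqrt (real P))"
      by (intro mult_left_mono) auto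
    also have "\<dots> = 2 * real P" by simp
    finally show ?thesis using lnP by (simp add: pos_le_divide_eq)
  qed
  also have "real (P - 1) * (2 / ln (real P)) \<le> real P * (2 / ln (real P))"
    using lnP by (intro mult_right_mono) auto
  finally show ?thesis by (simp add: field_simps)
qed

text \<open>Since \<open>lpf (d * m)\<close> is at most the number of j \<le> \<open>lpf d\<close>
  for which m is j-rough, the sum is controlled by rough counts. This saves the logarithm that the
  trivial bound \<open>lpf d\<close> lacks. The 97 is 16 times 6 plus 1 for j = 1.\<close>

lemma sum_lpf_multiples_le:
  assumes d: "d \<ge> 2" and x: "x \<ge> 1"
  shows "(\<Sum>m=1..x. real (lpf (d * m))) \<le> 97 * real x * (real (lpf d) / ln (real (lpf d))) + real (lpf d)"
proof -
  define P where "P = lpf d"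
  have P: "prime P" "P dvd d" "P \<ge> 2" using lpf[OF d] by (auto simp: P_def)
  have lnP: "ln (real P) > 0" using P by simp
  have "(\<Sum>m=1..x. real (lpf (d * m))) \<le> (\<Sum>m=1..x. \<Sum>j=1..P. if rough j m then 1 else 0)"
  proof (intro sum_mono)
    fix m assume m: "m \<in> {1..x}"
    have "d * 1 \<le> d * m" using m by (intro mult_le_mono) auto
    hence dm: "d * m \<ge> 2" using d by linarith
    have le: "lpf (d * m) \<le> P" using P by (intro lpf_le) auto
    have "{1..lpf (d * m)} \<subseteq> {j\<in>{1..P}. rough j m}"
    proof
      fix j assume j: "j \<in> {1..lpf (d * m)}"
      hence "rough j (d * m)" using le_lpf_iff[OF dm, of j] by simp
      thus "j \<in> {j\<in>{1..P}. rough j m}" using j le by (simp add: rough_mult_iff)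
    qed
    hence "card {1..lpf (d * m)} \<le> card {j\<in>{1..P}. rough j m}" by (intro card_mono) auto
    thus "real (lpf (d * m)) \<le> (\<Sum>j=1..P. if rough j m then 1 else 0)"
      by (simp add: sum.inter_filter[symmetric])
  qed
  also have "\<dots> = (\<Sum>j=1..P. \<Sum>m=1..x. if rough j m then 1 else 0)" by (rule sum.swap)
  also have "\<dots> = (\<Sum>j=1..P. real (rough_count (real x) j))"
    by (simp add: sum.inter_filter[symmetric] rough_count_nat)
  also have "\<dots> = real (rough_count (real x) 1) + (\<Sum>j=2..P. real (rough_count (real x) j))"
    using P by (subst sum.atLeast_Suc_atMost) (auto simp: numeral_2_eq_2)
  also have "rough_count (real x) 1 \<le> card {1..x}"
    unfolding rough_count_nat by (intro card_mono) auto
  also have "card {1..x} = x" by simp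
  also have "(\<Sum>j=2..P. real (rough_count (real x) j)) \<le> (\<Sum>j=2..P. 16 * real x * (1 / ln (real j)) + 1)"
    using rough_count_upper[OF _ x] by (intro sum_mono) auto
  also have "\<dots> = 16 * real x * (\<Sum>j=2..P. 1 / ln (real j)) + real (P - 1)"
    by (simp add: sum.distrib sum_distrib_left)
  also have "\<dots> \<le> 16 * real x * (6 * real P / ln (real P)) + real P"
    using P by (intro add_mono mult_left_mono sum_inverse_ln_le) auto
  also have "real x + (16 * real x * (6 * real P / ln (real P)) + real P) \<le>
               97 * real x * (real P / ln (real P)) + real P"
  proof -
    have "ln (real P) \<le> real P" using ln_le_minus_one[of "real P"] P by simp
    hence "1 \<le> real P / ln (real P)" using lnP by simp
    hence "real x * 1 \<le> real x * (real P / ln (real P))" by (intro mult_left_mono) auto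
    hence Y: "real x \<le> real x * (real P / ln (real P))" by simp
    define Y where "Y = real x * (real P / ln (real P))"
    have eqs: "16 * real x * (6 * real P / ln (real P)) = 96 * Y"
      "97 * real x * (real P / ln (real P)) = 97 * Y" by (simp_all add: Y_def)
    show ?thesis unfolding eqs using Y[folded Y_def] by linarith
  qed
  finally show ?thesis by (simp add: P_def)
qed

lemma sum_inverse_squares_le: "(\<Sum>e=1..n. 1 / (real e)\<^sup>2) \<le> 2"
proof -
  have "(\<Sum>e=1..Suc n. 1 / (real e)\<^sup>2) \<le> 2 - 1 / real (Suc n)" for n
  proof (induction n)
    case (Suc n)
    have "1 / (real (Suc (Suc n)))\<^sup>2 \<le> 1 / real (Suc n) - 1 / real (Suc (Suc n))"
    proof -
      have "1 / (real (Suc (Suc n)))\<^sup>2 \<le> 1 / (real (Suc n) * real (Suc (Suc n)))"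
        unfolding power2_eq_square by (intro divide_left_mono mult_right_mono) auto
      thus ?thesis by (simp add: field_simps)
    qed
    thus ?case using Suc by simp
  qed simp
  note * = this
  show ?thesis
  proof (cases n)
    case (Suc m)
    have "1 / real (Suc m) \<ge> 0" by simp
    thus ?thesis unfolding Suc using *[of m] by linarith
  qed simp
qed

text \<open>For d = p e with p = \<open>lpf d\<close> the term equals 1 / (p ln p) times 1 / e^2.
  Letting e range over all positive integers separates the two sums, and both converge.\<close>

lemma sum_lpf_weight_bounded:
  obtains K where "K \<ge> 0" "\<And>N. (\<Sum>d=2..N. real (lpf d) / ((real d)\<^sup>2 * ln (real (lpf d)))) \<le> K"
proof -
  obtain K where K: "\<And>n. (\<Sum>k=2..n. prime_log k / ln (real k)) \<le> K"
    using sum_prime_log_over_ln_bounded by blast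
  have K0: "K \<ge> 0" using K[of 0] by simp
  show ?thesis
  proof (rule that[of "K * 2"])
    show "K * 2 \<ge> 0" using K0 by simp
    fix N
    define f where "f = (\<lambda>(p,e). prime_log p / ln (real p) * (1 / (real e)\<^sup>2))"
    define h where "h = (\<lambda>d. (lpf d, d div lpf d))"
    have "(\<Sum>d=2..N. real (lpf d) / ((real d)\<^sup>2 * ln (real (lpf d)))) \<le> (\<Sum>d=2..N. f (h d))"
    proof (intro sum_mono)
      fix d assume d: "d \<in> {2..N}"
      define p where "p = lpf d"
      have p: "prime p" "p dvd d" "p \<ge> 2" using lpf[of d] d by (auto simp: p_def)
      then obtain e where e: "d = p * e" by blast
      have "e > 0" using e d by (cases e) auto
      hence "real p / ((real d)\<^sup>2 * ln (real p)) = 1 / real p / ln (real p) * (1 / (real e)\<^sup>2)"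
        using p by (simp add: e field_simps power2_eq_square)
      also have "\<dots> \<le> prime_log p / ln (real p) * (1 / (real e)\<^sup>2)"
        using p prime_log_bounds(1)[OF p(1)] by (intro mult_right_mono divide_right_mono) auto
      also have "\<dots> = f (h d)"
      proof -
        have "d div p = e" using p e by simp
        thus ?thesis by (simp add: f_def h_def p_def[symmetric])
      qed
      finally show "real (lpf d) / ((real d)\<^sup>2 * ln (real (lpf d))) \<le> f (h d)" by (simp add: p_def)
    qed
    also have "\<dots> = sum f (h ` {2..N})"
    proof (subst sum.reindex)
      show "inj_on h {2..N}"
      proof (rule inj_onI)
        fix a b assume "a \<in> {2..N}" "b \<in> {2..N}" "h a = h b"
        thus "a = b" using dvd_mult_div_cancel[of "lpf a" a] dvd_mult_div_cancel[of "lpf b" b] lpf[of a] lpf[of b]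
          by (auto simp: h_def)
      qed
    qed simp
    also have "\<dots> \<le> sum f ({2..N} \<times> {1..N})"
    proof (intro sum_mono2)
      show "h ` {2..N} \<subseteq> {2..N} \<times> {1..N}"
      proof (rule image_subsetI)
        fix d assume d: "d \<in> {2..N}"
        have "d div lpf d > 0" using lpf[of d] d by (auto simp: div_greater_zero_iff)
        moreover have "d div lpf d \<le> N" using d by (auto intro: order_trans[OF div_le_dividend])
        ultimately show "h d \<in> {2..N} \<times> {1..N}" using lpf[of d] d by (auto simp: h_def)
      qed
      fix z assume z: "z \<in> {2..N} \<times> {1..N} - h ` {2..N}"
      then obtain p e where "z = (p, e)" "p \<ge> 2" by auto
      thus "f z \<ge> 0" using prime_log_nonneg[of p] by (simp add: f_def)
    qed simp
    also have "\<dots> = (\<Sum>p=2..N. prime_log p / ln (real p)) * (\<Sum>e=1..N. 1 / (real e)\<^sup>2)"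
      by (simp add: sum_product sum.cartesian_product f_def)
    also have "\<dots> \<le> K * 2"
      using K K0 sum_inverse_squares_le by (intro mult_mono sum_nonneg) auto
    finally show "(\<Sum>d=2..N. real (lpf d) / ((real d)\<^sup>2 * ln (real (lpf d)))) \<le> K * 2" .
  qed
qed

subsection \<open>The aliquot sum and the least prime factor\<close>

lemma aliquot_sum_over_self:
  assumes "n > 0"
  shows "real (aliquot_sum n) / real n = (\<Sum>d | d dvd n \<and> d > 1. 1 / real d)"
proof -
  have "real (aliquot_sum n) / real n = (\<Sum>d | d dvd n \<and> d < n. real d / real n)"
    by (simp add: aliquot_sum_def sum_divide_distrib)
  also have "\<dots> = (\<Sum>d | d dvd n \<and> d > 1. 1 / real d)"
  proof (rule sum.reindex_bij_witness[of _ "\<lambda>d. n div d" "\<lambda>d. n div d"])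
    fix d assume d: "d \<in> {d. d dvd n \<and> d < n}"
    then obtain k where k: "n = d * k" by blast
    have pos: "d > 0" "k > 0" using k assms by auto
    have "k \<noteq> 1" using d k by auto
    with pos show "n div d \<in> {d. d dvd n \<and> d > 1}" using k by auto
    show "n div (n div d) = d" using k pos by simp
    show "1 / real (n div d) = real d / real n" using k pos by simp
  next
    fix d assume d: "d \<in> {d. d dvd n \<and> d > 1}"
    then obtain k where k: "n = d * k" by blast
    have pos: "d > 0" "k > 0" using k assms by auto
    show "n div (n div d) = d" using k pos by simp
    show "n div d \<in> {d. d dvd n \<and> d < n}" using k pos d by simp
  qed
  finally show ?thesis .
qed

lemma lpf_aliquot_ge_1:
  assumes "n \<ge> 2"
  shows "1 \<le> real (lpf n) * (real (aliquot_sum n) / real n)"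
proof -
  have "1 / real (lpf n) = (\<Sum>d\<in>{lpf n}. 1 / real d)" by simp
  also have "\<dots> \<le> (\<Sum>d | d dvd n \<and> d > 1. 1 / real d)"
    using lpf[OF assms] assms by (intro sum_mono2) auto
  also have "\<dots> = real (aliquot_sum n) / real n" using assms by (subst aliquot_sum_over_self) auto
  finally show ?thesis using lpf(4)[OF assms] by (simp add: field_simps)
qed

text \<open>The divisors \<open>d\<close> with least prime factor \<open>p\<close> contribute about \<open>N / (p ln p)\<close>: the sieve saves
  the factor \<open>ln p\<close> that makes the sum over \<open>p\<close> converge.\<close>

lemma sum_lpf_aliquot_bounded:
  obtains C where "C \<ge> 0"
    "\<And>N. (\<Sum>n=2..N. real (lpf n) * (real (aliquot_sum n) / real n)) \<le> C * real N"
proof -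
  obtain K where K: "K \<ge> 0"
      "\<And>N. (\<Sum>d=2..N. real (lpf d) / ((real d)\<^sup>2 * ln (real (lpf d)))) \<le> K"
    using sum_lpf_weight_bounded by blast
  show ?thesis
  proof (rule that[of "97 * K + 1"])
    show "97 * K + 1 \<ge> 0" using K by simp
    fix N :: nat
    define g :: "nat \<times> nat \<Rightarrow> real" where "g = (\<lambda>(d,m). real (lpf (d * m)) / real d)"
    define h :: "nat \<times> nat \<Rightarrow> nat \<times> nat" where "h = (\<lambda>(n,d). (d, n div d))"
    define S where "S = Sigma {2..N} (\<lambda>n. {d. d dvd n \<and> d > 1})"
    have "(\<Sum>n=2..N. real (lpf n) * (real (aliquot_sum n) / real n)) =
          (\<Sum>n=2..N. \<Sum>d | d dvd n \<and> d > 1. real (lpf n) / real d)"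
      by (intro sum.cong refl) (simp add: aliquot_sum_over_self sum_distrib_left)
    also have "\<dots> = (\<Sum>(n,d)\<in>S. real (lpf n) / real d)"
      unfolding S_def by (intro sum.Sigma) auto
    also have "\<dots> = sum g (h ` S)"
    proof (subst sum.reindex)
      show "inj_on h S"
        by (auto simp: inj_on_def h_def S_def elim!: dvdE)
      show "(\<Sum>(n,d)\<in>S. real (lpf n) / real d) = sum (g \<circ> h) S"
        by (intro sum.cong) (auto simp: g_def h_def S_def)
    qed
    also have "\<dots> \<le> sum g (Sigma {2..N} (\<lambda>d. {1..N div d}))"
    proof (intro sum_mono2)
      show "h ` S \<subseteq> Sigma {2..N} (\<lambda>d. {1..N div d})"
      proof (rule image_subsetI)
        fix z assume "z \<in> S"
        then obtain n d where z: "z = (n, d)" "n \<in> {2..N}" "d dvd n" "d > 1" by (auto simp: S_def)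
        have "d \<le> n" using z by (intro dvd_imp_le) auto
        moreover have "n div d \<le> N div d" using z by (intro div_le_mono) auto
        moreover have "n div d > 0" using z \<open>d \<le> n\<close> by (simp add: div_greater_zero_iff)
        ultimately show "h z \<in> Sigma {2..N} (\<lambda>d. {1..N div d})" using z by (auto simp: h_def)
      qed
    qed (auto simp: g_def)
    also have "\<dots> = (\<Sum>d=2..N. \<Sum>m=1..N div d. real (lpf (d * m)) / real d)"
      unfolding g_def by (subst sum.Sigma) auto
    also have "\<dots> \<le> (\<Sum>d=2..N. 97 * real N * (real (lpf d) / ((real d)\<^sup>2 * ln (real (lpf d)))) + 1)"
    proof (intro sum_mono)
      fix d assume d: "d \<in> {2..N}"
      define P where "P = lpf d"
      have P: "P \<le> d" "2 \<le> P" using lpf[of d] d by (auto simp: P_def)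
      have lnP: "ln (real P) > 0" using P by simp
      have x: "N div d \<ge> 1" using d by (simp add: div_greater_zero_iff Suc_le_eq)
      have "(\<Sum>m=1..N div d. real (lpf (d * m)) / real d) = (\<Sum>m=1..N div d. real (lpf (d * m))) / real d"
        by (simp add: sum_divide_distrib)
      also have "\<dots> \<le> (97 * real (N div d) * (real P / ln (real P)) + real P) / real d"
        unfolding P_def using d x by (intro divide_right_mono sum_lpf_multiples_le) auto
      \<comment> \<open>Bounding the additive \<open>lpf d\<close> by d leaves 1 after division by
        d, so that these terms add up to at most N.\<close>
      also have "\<dots> \<le> (97 * (real N / real d) * (real P / ln (real P)) + real d) / real d"
        using P lnP by (intro divide_right_mono add_mono mult_right_mono mult_left_mono of_nat_div_le_of_nat) auto
      also have "\<dots> = 97 * real N * (real P / ((real d)\<^sup>2 * ln (real P))) + 1"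
        using d by (simp add: add_divide_distrib power2_eq_square)
      finally show "(\<Sum>m=1..N div d. real (lpf (d * m)) / real d) \<le>
          97 * real N * (real (lpf d) / ((real d)\<^sup>2 * ln (real (lpf d)))) + 1" by (simp add: P_def)
    qed
    also have "\<dots> = 97 * real N * (\<Sum>d=2..N. real (lpf d) / ((real d)\<^sup>2 * ln (real (lpf d)))) + real (N - 1)"
      by (simp add: sum.distrib sum_distrib_left)
    also have "\<dots> \<le> 97 * real N * K + real N"
      by (intro add_mono mult_left_mono K) auto
    finally show "(\<Sum>n=2..N. real (lpf n) * (real (aliquot_sum n) / real n)) \<le> (97 * K + 1) * real N"
      by (simp add: algebra_simps)
  qed
qed

text \<open>Passing from ln p to \<open>harm p\<close> costs between 0 and 1 for each n. The other
  discrepancy, N - \<open>harm N\<close>, acts in the opposite direction, so the two together stay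
  within N.\<close>

lemma sum_ln_lpf:
  assumes "N \<ge> 2"
  shows "\<bar>(\<Sum>n=2..N. ln (real (lpf n))) - (\<Sum>j=2..N. real (rough_count (real N) j) / real j)\<bar> \<le> real N"
proof -
  define T where "T = (\<Sum>j=2..N. real (rough_count (real N) j) / real j)"
  define H where "H = (\<Sum>n=2..N. harm (lpf n) :: real)"
  have "H = (\<Sum>n=2..N. \<Sum>j=1..N. if rough j n then 1 / real j else 0)"
    unfolding H_def
  proof (intro sum.cong refl)
    fix n assume n: "n \<in> {2..N}"
    have "{1..lpf n} = {j\<in>{1..N}. rough j n}"
    proof (intro set_eqI)
      fix j
      have "j \<le> lpf n \<longleftrightarrow> rough j n" "lpf n \<le> N" using n lpf(3)[of n] le_lpf_iff[of n j] by auto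
      thus "j \<in> {1..lpf n} \<longleftrightarrow> j \<in> {j\<in>{1..N}. rough j n}"
        using order_trans[of j "lpf n" N] by auto
    qed
    thus "harm (lpf n) = (\<Sum>j=1..N. if rough j n then 1 / real j else 0)"
      by (simp add: harm_def sum.inter_filter[symmetric] divide_inverse)
  qed
  also have "\<dots> = (\<Sum>j=1..N. \<Sum>n=2..N. if rough j n then 1 / real j else 0)" by (rule sum.swap)
  \<comment> \<open>The subtracted 1 is n = 1, which \<open>rough_count\<close> includes at every
    level while the sum starts at 2.\<close>
  also have "\<dots> = (\<Sum>j=1..N. (real (rough_count (real N) j) - 1) / real j)"
  proof (intro sum.cong refl)
    fix j
    have "{m\<in>{1..N}. rough j m} = insert 1 {m\<in>{2..N}. rough j m}" using assms by auto
    hence "rough_count (real N) j = Suc (card {m\<in>{2..N}. rough j m})"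
      by (simp add: rough_count_nat)
    thus "(\<Sum>n=2..N. if rough j n then 1 / real j else 0) = (real (rough_count (real N) j) - 1) / real j"
      by (simp add: sum.inter_filter[symmetric])
  qed
  also have "\<dots> = (\<Sum>j=1..N. real (rough_count (real N) j) / real j) - harm N"
    by (simp add: left_diff_distrib sum_subtractf harm_def divide_inverse)
  also have "(\<Sum>j=1..N. real (rough_count (real N) j) / real j) = real (rough_count (real N) 1) + T"
    unfolding T_def using assms by (subst sum.atLeast_Suc_atMost) (auto simp: numeral_2_eq_2)
  also have "rough_count (real N) 1 = N"
  proof -
    have "{m\<in>{1..N}. rough 1 m} = {1..N}" by (auto simp: rough_le_2)
    thus ?thesis by (simp add: rough_count_nat)
  qed
  finally have HT: "H = real N + T - harm N" .
  have harmN: "0 \<le> (harm N :: real)" "harm N \<le> real N"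
  proof -
    show "0 \<le> (harm N :: real)" by (rule harm_nonneg)
    have "harm N \<le> ln (real N) + 1" using assms by (intro harm_le_ln) auto
    thus "harm N \<le> real N" using ln_le_minus_one[of "real N"] assms by simp
  qed
  have "(\<Sum>n=2..N. ln (real (lpf n))) \<le> H" unfolding H_def
  proof (intro sum_mono)
    fix n assume "n \<in> {2..N}"
    hence "ln (real (lpf n)) \<le> ln (real (lpf n) + 1)" using lpf(4)[of n] by simp
    thus "ln (real (lpf n)) \<le> harm (lpf n)" using ln_le_harm[of "lpf n"] by simp
  qed
  moreover have "H \<le> (\<Sum>n=2..N. ln (real (lpf n)) + 1)" unfolding H_def
  proof (intro sum_mono)
    fix n assume "n \<in> {2..N}"
    thus "harm (lpf n) \<le> ln (real (lpf n)) + 1" using lpf(4)[of n] by (intro harm_le_ln) auto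
  qed
  hence "H \<le> (\<Sum>n=2..N. ln (real (lpf n))) + real (N - 1)" by (simp add: sum.distrib)
  ultimately show ?thesis using HT harmN unfolding T_def[symmetric] by linarith
qed

section \<open>Discrete integral comparison for 1 / (j ln j) and 1 / (j (ln j)^2)\<close>

lemma inverse_ln_term_bounds:
  assumes "j \<ge> 2"
  shows "ln (ln (real (Suc j))) - ln (ln (real j)) \<le> 1 / (real j * ln (real j))"
        "1 / (real (Suc j) * ln (real (Suc j))) \<le> ln (ln (real (Suc j))) - ln (ln (real j))"
        "1 / (real (Suc j) * (ln (real (Suc j)))\<^sup>2) \<le> 1 / ln (real j) - 1 / ln (real (Suc j))"
proof -
  define l where "l = ln (real (Suc j)) - ln (real j)"
  have lnj: "ln (real j) > 0" "ln (real j) \<le> ln (real (Suc j))" using assms by auto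
  have l: "1 / real (Suc j) \<le> l" "l \<le> 1 / real j"
    using ln_ratio_bounds[of "real j" "real (Suc j)"] assms by (auto simp: l_def)
  have "ln (ln (real (Suc j))) - ln (ln (real j)) \<le> l / ln (real j)"
    unfolding l_def using lnj by (intro ln_ratio_bounds) auto
  also have "\<dots> \<le> (1 / real j) / ln (real j)" using l lnj by (intro divide_right_mono) auto
  finally show "ln (ln (real (Suc j))) - ln (ln (real j)) \<le> 1 / (real j * ln (real j))" by simp
  have "1 / real (Suc j) / ln (real (Suc j)) \<le> l / ln (real (Suc j))"
    using l lnj by (intro divide_right_mono) auto
  also have "\<dots> \<le> ln (ln (real (Suc j))) - ln (ln (real j))"
    unfolding l_def using lnj by (intro ln_ratio_bounds) auto
  finally show "1 / (real (Suc j) * ln (real (Suc j))) \<le> ln (ln (real (Suc j))) - ln (ln (real j))" by simp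
  have "1 / real (Suc j) / (ln (real (Suc j)))\<^sup>2 \<le> l / (ln (real j) * ln (real (Suc j)))"
    unfolding power2_eq_square using l lnj assms order_trans[OF _ l(1), of 0] by (intro frac_le mult_right_mono mult_pos_pos) auto
  also have "\<dots> = 1 / ln (real j) - 1 / ln (real (Suc j))"
  proof -
    have "ln (real j) \<noteq> 0" "ln (real (Suc j)) \<noteq> 0" using lnj by linarith+
    thus ?thesis by (simp add: l_def diff_divide_distrib del: of_nat_Suc)
  qed
  finally show "1 / (real (Suc j) * (ln (real (Suc j)))\<^sup>2) \<le> 1 / ln (real j) - 1 / ln (real (Suc j))" by simp
qed

lemma sum_inverse_j_ln_tail:
  assumes "2 \<le> m" "m \<le> n"
  shows "(\<Sum>j=Suc m..n. 1 / (real j * ln (real j))) \<le> ln (ln (real n)) - ln (ln (real m))"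
  using assms(2)
proof (induction n rule: dec_induct)
  case (step n)
  thus ?case using inverse_ln_term_bounds(2)[of n] assms by simp
qed simp

lemma sum_inverse_j_ln:
  assumes "n \<ge> 2"
  shows "\<bar>(\<Sum>j=2..n. 1 / (real j * ln (real j))) - ln (ln (real n))\<bar> \<le> 1 / ln 2 - ln (ln 2)"
proof -
  have "(\<Sum>j=2..n. 1 / (real j * ln (real j))) = 1 / (2 * ln 2) + (\<Sum>j=Suc 2..n. 1 / (real j * ln (real j)))"
    using assms by (subst sum.atLeast_Suc_atMost) auto
  moreover have "1 / (2 * ln 2) \<le> 1 / ln (2::real)" by (simp add: field_simps)
  ultimately have up: "(\<Sum>j=2..n. 1 / (real j * ln (real j))) \<le> 1 / ln 2 + ln (ln (real n)) - ln (ln 2)"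
    using sum_inverse_j_ln_tail[of 2 n] assms by simp
  have "(\<Sum>j=2..n. 1 / (real j * ln (real j))) \<ge> ln (ln (real (Suc n))) - ln (ln 2)"
    using assms
  proof (induction n rule: dec_induct)
    case base
    show ?case using inverse_ln_term_bounds(1)[of 2] by simp
  next
    case (step n)
    have "(\<Sum>j=2..Suc n. 1 / (real j * ln (real j))) =
          (\<Sum>j=2..n. 1 / (real j * ln (real j))) + 1 / (real (Suc n) * ln (real (Suc n)))"
      using step by simp
    thus ?case using step inverse_ln_term_bounds(1)[of "Suc n"] by linarith
  qed
  moreover have "ln (ln (real n)) \<le> ln (ln (real (Suc n)))"
    using assms by (intro ln_mono) auto
  moreover have "ln (ln 2) \<le> (0::real)" "1 / ln (2::real) \<ge> 0" using ln_2_less_1 by auto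
  ultimately show ?thesis using up by linarith
qed

lemma sum_inverse_j_ln_square:
  assumes "n \<ge> 2"
  shows "(\<Sum>j=2..n. 1 / (real j * (ln (real j))\<^sup>2)) \<le> 1 / (2 * (ln 2)\<^sup>2) + 1 / ln 2"
proof -
  have "(\<Sum>j=2..n. 1 / (real j * (ln (real j))\<^sup>2)) \<le> 1 / (2 * (ln 2)\<^sup>2) + 1 / ln 2 - 1 / ln (real n)"
    using assms
  proof (induction n rule: dec_induct)
    case (step n)
    have "(\<Sum>j=2..Suc n. 1 / (real j * (ln (real j))\<^sup>2)) =
          (\<Sum>j=2..n. 1 / (real j * (ln (real j))\<^sup>2)) + 1 / (real (Suc n) * (ln (real (Suc n)))\<^sup>2)"
      using step by simp
    thus ?case using step inverse_ln_term_bounds(3)[of n] by linarith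
  qed simp
  moreover have "1 / ln (real n) \<ge> 0" using assms by simp
  ultimately show ?thesis by linarith
qed

lemma rough_count_error:
  obtains C where "C \<ge> 0" "\<And>N j. 3 \<le> N \<Longrightarrow> ln (ln (real N)) > 0 \<Longrightarrow> j \<in> {2..N} \<Longrightarrow>
    \<bar>real (rough_count (real N) j) - real N * exp (- euler_mascheroni) / ln (real j)\<bar> \<le>
      real N * (C / (ln (real N))\<^sup>2 + C / (ln (real j))\<^sup>2 +
        (if ln (real j) \<le> ln (real N) / (5 * ln (ln (real N))) then 0 else 17 / ln (real j)))"
proof -
  obtain C1 where C1: "C1 \<ge> 0" "\<And>x j. x > 0 \<Longrightarrow> j \<ge> 3 \<Longrightarrow>
    \<bar>real (rough_count x j) - x * sieve_density j\<bar> \<le> C1 * x * ln (real j) ^ 3 * exp (- ln x / ln (real j))"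
    using legendre_rankin by blast
  obtain C2 where C2: "C2 \<ge> 0" "\<And>j. j \<ge> 2 \<Longrightarrow>
    \<bar>sieve_density j - exp (- euler_mascheroni) / ln (real j)\<bar> \<le> C2 / (ln (real j))\<^sup>2"
    using mertens_third by blast
  \<comment> \<open>The summand 17 serves j = 2, which the sieve estimate does not reach: there the
    crude bound 17 / ln j is absorbed into C / (ln j)^2.\<close>
  define C where "C = C1 + C2 + 17"
  show ?thesis
  proof (rule that[of C])
    show "C \<ge> 0" using C1 C2 by (simp add: C_def)
    fix N j :: nat
    assume N: "3 \<le> N" and L2: "ln (ln (real N)) > 0" and j: "j \<in> {2..N}"
    define E where "E = exp (- euler_mascheroni :: real)"
    define w where "w = ln (real N) / (5 * ln (ln (real N)))"
    have E: "0 < E" "E \<le> 1" using euler_mascheroni_pos by (auto simp: E_def)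
    have lnj: "ln (real j) > 0" "ln (real j) \<le> ln (real N)" using j by auto
    have lnN: "ln (real N) > 0" using lnj by linarith
    have nn: "C / (ln (real N))\<^sup>2 \<ge> 0" "C / (ln (real j))\<^sup>2 \<ge> 0" using \<open>C \<ge> 0\<close> by auto
    \<comment> \<open>This crude bound discards the main term: a count of at most 16 N / ln j + 1
      and a main term of at most N / ln j differ by at most 17 N / ln j.\<close>
    have large: "\<bar>real (rough_count (real N) j) - real N * E / ln (real j)\<bar> \<le> real N * (17 / ln (real j))"
    proof -
      have "ln (real j) \<le> real N" using lnj(2) ln_le_minus_one[of "real N"] N by simp
      hence 1: "1 \<le> real N / ln (real j)" using lnj by simp
      have 2: "real (rough_count (real N) j) \<le> 16 * (real N / ln (real j)) + 1"
        using rough_count_upper[of j N] j by simp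
      have 3: "real N * E / ln (real j) \<le> real N / ln (real j)"
        using E lnj by (intro divide_right_mono mult_left_le) auto
      have 4: "real N * E / ln (real j) \<ge> 0" using E lnj by simp
      have "\<bar>a - c\<bar> \<le> 17 * q" if "1 \<le> q" "a \<le> 16 * q + 1" "c \<le> q" "0 \<le> c" "0 \<le> a" for a c q :: real
        using that by linarith
      from this[OF 1 2 3 4] show ?thesis by (simp add: mult.commute)
    qed
    consider "j = 2" | "j \<ge> 3" "ln (real j) \<le> w" | "\<not>ln (real j) \<le> w" using j by fastforce
    thus "\<bar>real (rough_count (real N) j) - real N * E / ln (real j)\<bar> \<le>
      real N * (C / (ln (real N))\<^sup>2 + C / (ln (real j))\<^sup>2 + (if ln (real j) \<le> w then 0 else 17 / ln (real j)))"
    proof cases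
      case 1
      have "17 / ln (real j) \<le> C / (ln (real j))\<^sup>2"
      proof -
        have "17 * ln (2::real) \<le> C" using ln_2_less_1 C1 C2 unfolding C_def by linarith
        thus ?thesis using 1 by (simp add: field_simps power2_eq_square)
      qed
      hence "real N * (17 / ln (real j)) \<le> real N * (C / (ln (real N))\<^sup>2 + C / (ln (real j))\<^sup>2 + (if ln (real j) \<le> w then 0 else 17 / ln (real j)))"
        using nn lnj by (intro mult_left_mono) auto
      thus ?thesis using large by linarith
    next
      case 2
      have "\<bar>real (rough_count (real N) j) - real N * sieve_density j\<bar> \<le>
          C1 * real N * ln (real j) ^ 3 * exp (- ln (real N) / ln (real j))"
        using C1(2)[of "real N" j] 2 N by simp
      also have "\<dots> \<le> C1 * real N * ln (real N) ^ 3 * (1 / ln (real N) ^ 5)"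
      proof (intro mult_mono power_mono)
        have "5 * ln (ln (real N)) * ln (real j) \<le> ln (real N)"
          using 2(2) L2 by (simp add: w_def field_simps)
        hence "5 * ln (ln (real N)) \<le> ln (real N) / ln (real j)"
          using lnj by (simp add: pos_le_divide_eq)
        hence "exp (- ln (real N) / ln (real j)) \<le> exp (- (5 * ln (ln (real N))))" by simp
        also have "\<dots> = 1 / exp (real 5 * ln (ln (real N)))" by (simp add: exp_minus divide_inverse)
        also have "exp (real 5 * ln (ln (real N))) = ln (real N) ^ 5"
          unfolding exp_of_nat_mult using lnN by simp
        finally show "exp (- ln (real N) / ln (real j)) \<le> 1 / ln (real N) ^ 5" .
      qed (use C1 lnj lnN in auto)
      also have "\<dots> = real N * (C1 / (ln (real N))\<^sup>2)"
        using lnN by (simp add: field_simps eval_nat_numeral)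
      finally have a: "\<bar>real (rough_count (real N) j) - real N * sieve_density j\<bar> \<le> real N * (C1 / (ln (real N))\<^sup>2)" .
      have "real N * \<bar>sieve_density j - E / ln (real j)\<bar> \<le> real N * (C2 / (ln (real j))\<^sup>2)"
        unfolding E_def using C2(2)[of j] j by (intro mult_left_mono) auto
      hence "\<bar>real N * sieve_density j - real N * E / ln (real j)\<bar> \<le> real N * (C2 / (ln (real j))\<^sup>2)"
        by (simp add: abs_mult[of "real N", simplified, symmetric] right_diff_distrib)
      hence "\<bar>real (rough_count (real N) j) - real N * E / ln (real j)\<bar> \<le>
               real N * (C1 / (ln (real N))\<^sup>2) + real N * (C2 / (ln (real j))\<^sup>2)" using a by linarith
      also have "\<dots> = real N * (C1 / (ln (real N))\<^sup>2 + C2 / (ln (real j))\<^sup>2)" by (simp only: distrib_left)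
      also have "\<dots> \<le> real N * (C / (ln (real N))\<^sup>2 + C / (ln (real j))\<^sup>2)"
        using C1 C2 by (intro mult_left_mono add_mono divide_right_mono) (auto simp: C_def)
      finally show ?thesis using 2 by simp
    next
      case 3
      hence "real N * (17 / ln (real j)) \<le> real N * (C / (ln (real N))\<^sup>2 + C / (ln (real j))\<^sup>2 + (if ln (real j) \<le> w then 0 else 17 / ln (real j)))"
        using nn by (intro mult_left_mono) auto
      thus ?thesis using large by linarith
    qed
  qed
qed

text \<open>The sum is about ln ln N - ln w = ln (5 ln ln N). Truncating exp w to an integer m only
  guarantees ln m \<ge> w / 2, which doubles the 5 to 10.\<close>

lemma sum_inverse_j_ln_large:
  fixes w :: real
  assumes N: "2 \<le> N" "ln (ln (real N)) > 0" and w: "w \<ge> 2" "w = ln (real N) / (5 * ln (ln (real N)))" "w \<le> ln (real N)"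
  shows "(\<Sum>j\<in>{j\<in>{2..N}. \<not>ln (real j) \<le> w}. 1 / (real j * ln (real j))) \<le> ln (ln (ln (real N))) + ln 10"
proof -
  define m where "m = nat \<lfloor>exp w\<rfloor>"
  have ew: "exp w \<ge> 3" using exp_ge_add_one_self[of w] w by linarith
  have m: "real m \<le> exp w" "exp w < real m + 1" unfolding m_def using ew by linarith+
  have m2: "real m > 2" using m ew by linarith
  have "exp w \<le> real N" using w N by (subst ln_ge_iff[symmetric]) auto
  hence mN: "m \<le> N" using m by linarith
  have "exp w / 2 \<le> real m" using m ew by linarith
  hence "ln (exp w / 2) \<le> ln (real m)" by (intro ln_mono) auto
  hence "w - ln 2 \<le> ln (real m)" by (simp add: ln_div)
  hence lnm: "w / 2 \<le> ln (real m)" using w(1) ln_2_less_1 by linarith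
  have sub: "{j\<in>{2..N}. \<not>ln (real j) \<le> w} \<subseteq> {Suc m..N}"
  proof
    fix j assume j: "j \<in> {j\<in>{2..N}. \<not>ln (real j) \<le> w}"
    hence "exp w < exp (ln (real j))" by (subst exp_less_cancel_iff) auto
    also have "\<dots> = real j" using j by (intro exp_ln) auto
    finally have "real m < real j" using m by linarith
    thus "j \<in> {Suc m..N}" using j by simp
  qed
  have "(\<Sum>j\<in>{j\<in>{2..N}. \<not>ln (real j) \<le> w}. 1 / (real j * ln (real j))) \<le> (\<Sum>j=Suc m..N. 1 / (real j * ln (real j)))"
    using sub m2 by (intro sum_mono2) auto
  also have "\<dots> \<le> ln (ln (real N)) - ln (ln (real m))"
    using m2 mN by (intro sum_inverse_j_ln_tail) auto
  finally have "(\<Sum>j\<in>{j\<in>{2..N}. \<not>ln (real j) \<le> w}. 1 / (real j * ln (real j)))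
    \<le> ln (ln (real N)) - ln (ln (real m))" .
  moreover have "ln (w / 2) \<le> ln (ln (real m))" using lnm w by (intro ln_mono) auto
  moreover have "ln (w / 2) = ln (ln (real N)) - (ln (ln (ln (real N))) + ln 10)"
  proof -
    have "ln (real N) > 0" using w by linarith
    moreover have "w / 2 = ln (real N) / (ln (ln (real N)) * 10)" by (simp add: w(2))
    ultimately show ?thesis using N by (simp add: ln_div ln_mult)
  qed
  ultimately show ?thesis by linarith
qed

text \<open>After division by j, the first error term of \<open>rough_count_error\<close> meets a
  harmonic sum of size O(ln N) and stays bounded, the second converges, and only the third grows;
  its coefficient 17 is the one that survives.\<close>

lemma sum_rough_count_asymptotic:
  obtains C where "C \<ge> 0" "\<forall>\<^sub>F N in sequentially.
    \<bar>(\<Sum>j=2..N. real (rough_count (real N) j) / real j) - real N * (exp (- euler_mascheroni) * ln (ln (real N)))\<bar>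
       \<le> real N * (C + 17 * ln (ln (ln (real N))))"
proof -
  obtain C where C: "C \<ge> 0" "\<And>N j. 3 \<le> N \<Longrightarrow> ln (ln (real N)) > 0 \<Longrightarrow> j \<in> {2..N} \<Longrightarrow>
    \<bar>real (rough_count (real N) j) - real N * exp (- euler_mascheroni) / ln (real j)\<bar> \<le>
      real N * (C / (ln (real N))\<^sup>2 + C / (ln (real j))\<^sup>2 +
        (if ln (real j) \<le> ln (real N) / (5 * ln (ln (real N))) then 0 else 17 / ln (real j)))"
    using rough_count_error by blast
  define C0 where "C0 = 1 / ln 2 - ln (ln 2 :: real)"
  define K where "K = 1 / (2 * (ln 2)\<^sup>2) + 1 / ln (2::real)"
  define D where "D = 2 * C + C * K + 17 * ln 10 + C0"
  define E where "E = exp (- euler_mascheroni :: real)"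
  have E: "0 < E" "E \<le> 1" using euler_mascheroni_pos by (auto simp: E_def)
  have C0: "C0 \<ge> 0" using sum_inverse_j_ln[of 2] unfolding C0_def by linarith
  have K: "K \<ge> 0" by (simp add: K_def)
  show ?thesis
  proof (rule that[of D])
    show "D \<ge> 0" using C C0 K by (simp add: D_def)
    have "\<forall>\<^sub>F N::nat in sequentially. ln (real N) / (5 * ln (ln (real N))) \<ge> 2"
         "\<forall>\<^sub>F N::nat in sequentially. ln (real N) / (5 * ln (ln (real N))) \<le> ln (real N)"
         "\<forall>\<^sub>F N::nat in sequentially. ln (ln (real N)) > 0"
         "\<forall>\<^sub>F N::nat in sequentially. ln (real N) \<ge> 1"
      by real_asymp+
    thus "\<forall>\<^sub>F N in sequentially.
      \<bar>(\<Sum>j=2..N. real (rough_count (real N) j) / real j) - real N * (exp (- euler_mascheroni) * ln (ln (real N)))\<bar>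
       \<le> real N * (D + 17 * ln (ln (ln (real N))))"
      using eventually_ge_at_top[of 3] unfolding E_def[symmetric]
    proof eventually_elim
      case (elim N)
      define w where "w = ln (real N) / (5 * ln (ln (real N)))"
      define Q where "Q = (\<Sum>j=2..N. 1 / (real j * ln (real j)))"
      define T where "T = (\<Sum>j=2..N. real (rough_count (real N) j) / real j)"
      have N: "N \<ge> 3" by fact
      have "\<bar>T - real N * E * Q\<bar> = \<bar>\<Sum>j=2..N. (real (rough_count (real N) j) - real N * E / ln (real j)) / real j\<bar>"
        by (simp add: T_def Q_def sum_distrib_left sum_subtractf diff_divide_distrib mult.commute)
      also have "\<dots> \<le> (\<Sum>j=2..N. real N * (C / (ln (real N))\<^sup>2 + C / (ln (real j))\<^sup>2 +
                    (if ln (real j) \<le> w then 0 else 17 / ln (real j))) / real j)"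
      proof (rule order_trans[OF sum_abs], rule sum_mono)
        fix j assume j: "j \<in> {2..N}"
        show "\<bar>(real (rough_count (real N) j) - real N * E / ln (real j)) / real j\<bar> \<le>
            real N * (C / (ln (real N))\<^sup>2 + C / (ln (real j))\<^sup>2 + (if ln (real j) \<le> w then 0 else 17 / ln (real j))) / real j"
          unfolding abs_divide w_def E_def using C(2)[OF N elim(3) j] by (simp add: divide_right_mono)
      qed
      also have "\<dots> = (\<Sum>j=2..N. real N * (C / (ln (real N))\<^sup>2) * (1 / real j) +
            real N * C * (1 / (real j * (ln (real j))\<^sup>2)) +
            real N * 17 * (if \<not>ln (real j) \<le> w then 1 / (real j * ln (real j)) else 0))"
        by (intro sum.cong refl) (auto simp: field_simps)
      also have "\<dots> = real N * (C / (ln (real N))\<^sup>2) * (\<Sum>j=2..N. 1 / real j) +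
            real N * C * (\<Sum>j=2..N. 1 / (real j * (ln (real j))\<^sup>2)) +
            real N * 17 * (\<Sum>j\<in>{j\<in>{2..N}. \<not>ln (real j) \<le> w}. 1 / (real j * ln (real j)))"
        unfolding sum.distrib sum_distrib_left[symmetric]
        by (subst sum.inter_filter[symmetric]) simp_all
      also have "\<dots> \<le> real N * (2 * C) + real N * C * K + real N * 17 * (ln (ln (ln (real N))) + ln 10)"
      proof (intro add_mono)
        have "(\<Sum>j=2..N. 1 / real j) \<le> (\<Sum>j=1..N. 1 / real j)" by (intro sum_mono2) auto
        also have "\<dots> = harm N" by (simp add: harm_def divide_inverse)
        also have "\<dots> \<le> ln (real N) + 1" using N by (intro harm_le_ln) auto
        also have "\<dots> \<le> 2 * ln (real N)" using elim(4) by simp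
        also have "\<dots> \<le> 2 * (ln (real N))\<^sup>2" using elim(4) by (simp add: power2_eq_square)
        finally have "real N * (C / (ln (real N))\<^sup>2) * (\<Sum>j=2..N. 1 / real j) \<le>
            real N * (C / (ln (real N))\<^sup>2) * (2 * (ln (real N))\<^sup>2)"
          using C(1) by (intro mult_left_mono) auto
        also have "\<dots> = real N * (2 * C)" using elim(4) by simp
        finally show "real N * (C / (ln (real N))\<^sup>2) * (\<Sum>j=2..N. 1 / real j) \<le> real N * (2 * C)" .
        show "real N * C * (\<Sum>j=2..N. 1 / (real j * (ln (real j))\<^sup>2)) \<le> real N * C * K"
          unfolding K_def using N C(1) by (intro mult_left_mono sum_inverse_j_ln_square) auto
        show "real N * 17 * (\<Sum>j\<in>{j\<in>{2..N}. \<not>ln (real j) \<le> w}. 1 / (real j * ln (real j))) \<le>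
                real N * 17 * (ln (ln (ln (real N))) + ln 10)"
          using N elim by (intro mult_left_mono sum_inverse_j_ln_large) (auto simp: w_def)
      qed
      finally have 1: "\<bar>T - real N * E * Q\<bar> \<le> real N * (2 * C) + real N * C * K + real N * 17 * (ln (ln (ln (real N))) + ln 10)" .
      have "\<bar>real N * E * Q - real N * (E * ln (ln (real N)))\<bar> = real N * (E * \<bar>Q - ln (ln (real N))\<bar>)"
        using E by (simp add: abs_mult right_diff_distrib[symmetric] mult.assoc)
      also have "\<dots> \<le> real N * (1 * C0)"
        unfolding Q_def C0_def using E N by (intro mult_left_mono mult_mono sum_inverse_j_ln) auto
      finally have 2: "\<bar>real N * E * Q - real N * (E * ln (ln (real N)))\<bar> \<le> real N * C0" by simp
      have "real N * (D + 17 * ln (ln (ln (real N)))) =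
         (real N * (2 * C) + real N * C * K + real N * 17 * (ln (ln (ln (real N))) + ln 10)) + real N * C0"
        by (simp add: D_def algebra_simps)
      thus ?case using 1 2 unfolding T_def by linarith
    qed
  qed
qed

theorem theorem3p2:
  shows "(\<lambda>N::nat. (1 / real N) * (\<Sum>n = 2..N. ln (real (aliquot_sum n) / real n))
            + exp (- euler_mascheroni) * ln (ln (real N)))
         \<in> O(\<lambda>N::nat. ln (ln (ln (real N))))"
proof -
  obtain C where C: "C \<ge> 0" "\<forall>\<^sub>F N in sequentially.
    \<bar>(\<Sum>j=2..N. real (rough_count (real N) j) / real j) - real N * (exp (- euler_mascheroni) * ln (ln (real N)))\<bar>
       \<le> real N * (C + 17 * ln (ln (ln (real N))))"
    using sum_rough_count_asymptotic by blast
  obtain A where A: "A \<ge> 0"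
    "\<And>N. (\<Sum>n=2..N. real (lpf n) * (real (aliquot_sum n) / real n)) \<le> A * real N"
    using sum_lpf_aliquot_bounded by blast
  show ?thesis
  proof (rule bigoI)
    \<comment> \<open>From here on the bounded errors, A + C + 1 in total, are absorbed into ln ln
      ln N, so that 18 is 17 + 1.\<close>
    have "\<forall>\<^sub>F N::nat in sequentially. ln (ln (ln (real N))) \<ge> 1" by real_asymp
    with C(2) show "\<forall>\<^sub>F N::nat in sequentially.
        norm ((1 / real N) * (\<Sum>n = 2..N. ln (real (aliquot_sum n) / real n))
            + exp (- euler_mascheroni) * ln (ln (real N))) \<le>
        (A + C + 18) * norm (ln (ln (ln (real N))))"
      using eventually_ge_at_top[of 2]
    proof eventually_elim
      case (elim N)
      define M where "M = exp (- euler_mascheroni) * ln (ln (real N))"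
      define L3 where "L3 = ln (ln (ln (real N)))"
      define S where "S = (\<Sum>n = 2..N. ln (real (aliquot_sum n) / real n))"
      define X where "X = (\<Sum>n = 2..N. ln (real (lpf n) * (real (aliquot_sum n) / real n)))"
      define Y where "Y = (\<Sum>n = 2..N. ln (real (lpf n)))"
      have "S = X - Y" unfolding S_def X_def Y_def sum_subtractf[symmetric]
      proof (intro sum.cong refl)
        fix n assume n: "n \<in> {2..N}"
        have "real (lpf n) > 0" using lpf(4)[of n] n by simp
        moreover have "0 < real (lpf n) * (real (aliquot_sum n) / real n)"
          using lpf_aliquot_ge_1[of n] n by (intro less_le_trans[OF zero_less_one]) simp
        ultimately have "real (lpf n) > 0" "real (aliquot_sum n) / real n > 0"
          using zero_less_mult_pos by blast+
        from ln_mult_pos[OF this] show "ln (real (aliquot_sum n) / real n) =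
            ln (real (lpf n) * (real (aliquot_sum n) / real n)) - ln (real (lpf n))"
          by simp
      qed
      \<comment> \<open>Each factor under the logarithm is at least 1, so X has no negative part;
        the bound from above needs only ln t \<le> t and the mean of these factors.\<close>
      moreover have "X \<ge> 0" unfolding X_def
        using lpf_aliquot_ge_1 by (intro sum_nonneg ln_ge_zero) auto
      moreover have "X \<le> A * real N"
      proof -
        have "X \<le> (\<Sum>n = 2..N. real (lpf n) * (real (aliquot_sum n) / real n))" unfolding X_def
        proof (intro sum_mono)
          fix n assume "n \<in> {2..N}"
          hence "0 < real (lpf n) * (real (aliquot_sum n) / real n)"
            using lpf_aliquot_ge_1[of n] by (intro less_le_trans[OF zero_less_one]) auto
          from ln_le_minus_one[OF this]
          show "ln (real (lpf n) * (real (aliquot_sum n) / real n)) \<le> real (lpf n) * (real (aliquot_sum n) / real n)"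
            by linarith
        qed
        thus ?thesis using A(2)[of N] by linarith
      qed
      moreover have "\<bar>Y - (\<Sum>j=2..N. real (rough_count (real N) j) / real j)\<bar> \<le> real N"
        unfolding Y_def using elim by (intro sum_ln_lpf)
      ultimately have "\<bar>S + real N * M\<bar> \<le> A * real N + real N + real N * (C + 17 * L3)"
        using elim(1) unfolding M_def L3_def by linarith
      also have "\<dots> = real N * (A + 1 + C + 17 * L3)" by (simp add: algebra_simps)
      also have "\<dots> \<le> real N * ((A + C + 18) * L3)"
      proof (intro mult_left_mono)
        have L3: "L3 \<ge> 1" using elim by (simp add: L3_def)
        have "(A + 1 + C) * 1 \<le> (A + 1 + C) * L3" using L3 A C by (intro mult_left_mono) auto
        thus "A + 1 + C + 17 * L3 \<le> (A + C + 18) * L3" by (simp add: algebra_simps)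
      qed simp
      finally have "\<bar>S + real N * M\<bar> / real N \<le> (A + C + 18) * L3"
        using elim by (simp add: pos_divide_le_eq mult.commute)
      moreover have "(S + real N * M) / real N = (1 / real N) * S + M"
        using elim by (simp add: field_simps)
      hence "\<bar>S + real N * M\<bar> / real N = \<bar>(1 / real N) * S + M\<bar>"
        by (metis abs_divide abs_of_nat)
      moreover have "L3 \<ge> 1" using elim by (simp add: L3_def)
      ultimately show ?case unfolding S_def M_def L3_def by simp
    qed
  qed
qed

end
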